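(* Consider the stochastic block model $G_N$ with $M$ blocks of equal size $N/M$, with identical intra-block edge probabilities $p_1=\dots=p_M=p=p(N)$ and inter-block edge probability $q=q(N)$. Assume that $$\frac{M\log^4N}{Np+N(M-1)q}\xrightarrow[N\to\infty]{}0\qquad\text{and}\qquad q\gg\sqrt{\frac{p\log N}{NM}},$$ and that the limit $\kappa=\lim_{N\to\infty}\frac{(M-1)q}{p}\in[0,\infty]$ is well defined. Then, for $w\in V_N$, $$H_w=N(1+o(1))$$ asymptotically almost surely.
   Context: Model: $M$ is the (fixed) number of blocks and $N\to\infty$ runs through multiples of $M$ with $M<N$. The vertex set $V=V_N=\{1,\dots,N\}$ is partitioned into blocks $V^{(1)},\dots,V^{(M)}$ of size $N/M$ each. $p,q\in[0,1]$ depend on $N$. In the random graph $G_N=(V_N,E_N)$ the edge indicators of the unordered pairs $\{v,w\}$ (loops $v=w$ allowed) are independent; the edge $\{v,w\}$ is present with probability $p$ if $v,w$ are in the same block, and with probability $q$ if they are in different blocks. $a_{v,w}$ is the indicator of the edge $\{v,w\}$, $d_v=\sum_{w\in V}a_{v,w}$ (a loop counts once). $E$ is the edge set (including loops) and $L$ the set of loops, so $\sum_v d_v=2|E|-|L|$. Random walk: for a realization of $G_N$, the simple random walk in discrete time jumps from $v$ to $w$ with probability $1/d_v$ if $\{v,w\}\in E$, and $0$ otherwise. Its invariant distribution is $\pi_v=d_v/(2|E|-|L|)$. $H_{vw}$ is the expected time for the walk started in $v$ to reach $w$ (so $H_{ww}=0$), a random variable through the graph. Define $H_w=\sum_{v\in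 V}\pi_vH_{vw}$. The realization is tacitly assumed connected. Conventions: $b_N\gg a_N$ means $a_N/b_N\to0$. An event holds asymptotically almost surely (a.a.s.) if its probability tends to $1$ as $N\to\infty$; "$X_N=x_N(1+o(1))$ a.a.s." means that there is a deterministic sequence $\delta_N\to0$ with $|X_N/x_N-1|\le\delta_N$ a.a.s. *)

theory Defs
  imports "HOL-Probability.Probability"
begin

subsection \<open>The stochastic block model with equal blocks\<close>

text \<open>Graphs may have loops. An edge is the set of its endpoints, so a loop at \<open>v\<close> is the
  singleton \<open>{v}\<close>.\<close>

definition edge_slots :: "nat \<Rightarrow> nat set set" where
  "edge_slots N = {{v, w} | v w. v \<in> {1..N} \<and> w \<in> {1..N}}"

definition equal_blocks :: "nat \<Rightarrow> nat \<Rightarrow> nat set set \<Rightarrow> bool" where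
  "equal_blocks M N B \<longleftrightarrow>
     partition_on {1..N} B \<and> card B = M \<and> (\<forall>b\<in>B. M * card b = N)"

definition edge_prob :: "nat set set \<Rightarrow> real \<Rightarrow> real \<Rightarrow> nat set \<Rightarrow> real" where
  "edge_prob B p q e = (if \<exists>b\<in>B. e \<subseteq> b then p else q)"

definition sbm :: "nat \<Rightarrow> nat set set \<Rightarrow> real \<Rightarrow> real \<Rightarrow> nat set set pmf" where
  "sbm N B p q =
     map_pmf (\<lambda>a. {e \<in> edge_slots N. a e})
       (Pi_pmf (edge_slots N) False (\<lambda>e. bernoulli_pmf (edge_prob B p q e)))"


subsection \<open>The simple random walk and its hitting times\<close>

definition nbrs :: "nat set \<Rightarrow> nat set set \<Rightarrow> nat \<Rightarrow> nat set" where
  "nbrs V E v = {w \<in> V. {v, w} \<in> E}"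

abbreviation deg :: "nat set \<Rightarrow> nat set set \<Rightarrow> nat \<Rightarrow> nat" where
  "deg V E v \<equiv> card (nbrs V E v)"

definition loops :: "nat set set \<Rightarrow> nat set set" where
  "loops E = {e \<in> E. card e = 1}"

definition inv_dist :: "nat set \<Rightarrow> nat set set \<Rightarrow> nat \<Rightarrow> real" where
  "inv_dist V E v = real (deg V E v) / (2 * real (card E) - real (card (loops E)))"

text \<open>At a vertex without neighbours, where the jump probabilities \<open>1 / d\<^sub>v\<close> are meaningless, the
  walk is made to stay put.\<close>

definition rw_step :: "nat set \<Rightarrow> nat set set \<Rightarrow> nat \<Rightarrow> nat pmf" where
  "rw_step V E v = (if nbrs V E v = {} then return_pmf v else pmf_of_set (nbrs V E v))"

definition rw_kernel :: "nat set \<Rightarrow> nat set set \<Rightarrow> nat \<Rightarrow> nat \<Rightarrow> (nat \<Rightarrow> nat) \<Rightarrow> nat measure" where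
  "rw_kernel V E v i \<omega> =
     measure_pmf (if i = 0 then return_pmf v else rw_step V E (\<omega> (i - 1)))"

text \<open>The law of the trajectory of the walk started in \<open>v\<close>, obtained from the Ionescu-Tulcea
  extension theorem. Its finite-dimensional distributions are given in \<open>rw_measure_cylinder\<close>.\<close>

definition rw_measure :: "nat set \<Rightarrow> nat set set \<Rightarrow> nat \<Rightarrow> (nat \<Rightarrow> nat) measure" where
  "rw_measure V E v =
     projective_family.lim UNIV
       (Ionescu_Tulcea.CI (rw_kernel V E v) (\<lambda>_. count_space UNIV)) (\<lambda>_. count_space UNIV)"

lemma Ionescu_Tulcea_rw_kernel: "Ionescu_Tulcea (rw_kernel V E v) (\<lambda>_. count_space UNIV)"
proof (rule Ionescu_Tulcea.intro)
  fix i
  show "rw_kernel V E v i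
      \<in> measurable (PiM {0..<i} (\<lambda>_. count_space UNIV)) (subprob_algebra (count_space UNIV))"
  proof (cases "i = 0")
    case True
    then have "rw_kernel V E v i = (\<lambda>_. measure_pmf (return_pmf v))"
      by (auto simp: rw_kernel_def)
    then show ?thesis
      by (simp only:) (intro measurable_const measure_pmf_in_subprob_algebra)
  next
    case False
    have step: "(\<lambda>x. measure_pmf (rw_step V E x))
        \<in> measurable (count_space UNIV) (subprob_algebra (count_space UNIV))"
      by (simp add: measure_pmf_in_subprob_algebra)
    have comp: "(\<lambda>\<omega>. \<omega> (i - 1))
        \<in> measurable (PiM {0..<i} (\<lambda>_. count_space UNIV)) (count_space (UNIV :: nat set))"
      using False by (intro measurable_component_singleton) auto
    have "rw_kernel V E v i = (\<lambda>\<omega>. measure_pmf (rw_step V E (\<omega> (i - 1))))"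
      using False by (simp add: rw_kernel_def fun_eq_iff)
    then show ?thesis
      using measurable_compose[OF comp step] by (simp only:)
  qed
qed (unfold rw_kernel_def, rule measure_pmf.prob_space_axioms)

lemma prob_space_rw_measure: "prob_space (rw_measure V E v)"
proof -
  interpret Ionescu_Tulcea "rw_kernel V E v" "\<lambda>_. count_space UNIV"
    by (rule Ionescu_Tulcea_rw_kernel)
  let ?S = "space (PiM {} (\<lambda>_. count_space (UNIV :: nat set)))"
  interpret CI: prob_space "CI {}"
    by (rule PF.prob_space_P) auto
  have "space PF.lim = PF.emb UNIV {} ?S"
    by (auto simp: PF.space_lim prod_emb_def space_PiM restrict_def)
  then have "emeasure PF.lim (space PF.lim) = emeasure (CI {}) ?S"
    by (metis lim[of "{}" ?S] finite.emptyI sets.top)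
  also have "?S = space (CI {})"
    by (simp add: CI_def)
  finally have "emeasure PF.lim (space PF.lim) = 1"
    using CI.emeasure_space_1 by simp
  then show ?thesis
    unfolding rw_measure_def by (rule prob_spaceI)
qed

lemma rw_measure_cylinder:
  "emeasure (rw_measure V E v) {\<omega>. \<forall>i\<le>n. \<omega> i = x i} =
     (if x 0 = v then ennreal (\<Prod>i<n. pmf (rw_step V E (x i)) (x (Suc i))) else 0)"
proof -
  interpret Ionescu_Tulcea "rw_kernel V E v" "\<lambda>_. count_space UNIV"
    by (rule Ionescu_Tulcea_rw_kernel)
  let ?S = "\<lambda>m. space (PiM {0..<m} (\<lambda>_. count_space (UNIV :: nat set)))"
  let ?u = "\<lambda>_::nat. undefined :: nat"
  define A where "A m = {\<omega> \<in> ?S m. \<forall>i<m. \<omega> i = x i}" for m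
  define c where "c m = (if m = 0 then indicator {v} (x 0)
      else ennreal (pmf (rw_step V E (x (m - 1))) (x m)))" for m
  have A_eq: "A m = PiE {0..<m} (\<lambda>i. {x i})" for m
    by (auto simp: A_def space_PiM PiE_iff extensional_def)
  have A_sets[measurable]: "A m \<in> sets (PiM {0..<m} (\<lambda>_. count_space UNIV))" for m
    unfolding A_eq by (intro sets_PiM_I_finite) auto
  have step: "emeasure (eP m \<omega>) (A (Suc m)) = c m * indicator (A m) \<omega>" if "\<omega> \<in> ?S m" for m \<omega>
  proof -
    have "(\<lambda>y. fun_upd \<omega> m y) -` A (Suc m) = (if \<omega> \<in> A m then {x m} else {})"
      using that
      by (auto simp: A_def space_PiM PiE_iff less_Suc_eq extensional_def fun_eq_iff split: if_splits)
    moreover have "emeasure (rw_kernel V E v m \<omega>) {x m} = c m" if "\<omega> \<in> A m"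
      using that by (auto simp: rw_kernel_def c_def A_def emeasure_pmf_single indicator_def
          pmf_return)
    ultimately show ?thesis
      using emeasure_eP[OF that A_sets] by (auto split: if_splits)
  qed
  have C_A: "emeasure (C 0 m ?u) (A m) = (\<Prod>i<m. c i)" for m
  proof (induction m)
    case 0
    have "?u \<in> A 0"
      by (auto simp: A_def space_PiM)
    then show ?case
      using A_sets[of 0] by simp
  next
    case (Suc m)
    have u: "?u \<in> space (PiM {0..<0} (\<lambda>_. count_space (UNIV :: nat set)))"
      by (simp add: space_PiM)
    have sp: "space (C 0 m ?u) = ?S m" and st: "sets (C 0 m ?u) = sets (PiM {0..<m} (\<lambda>_. count_space UNIV))"
      using space_C[OF u, of m] sets_C[OF u, of m] by simp_all
    have ne: "space (C 0 m ?u) \<noteq> {}"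
      using prob_space.not_empty[OF prob_space_C[OF u]] .
    have "emeasure (C 0 (Suc m) ?u) (A (Suc m)) = (\<integral>\<^sup>+\<omega>. emeasure (eP m \<omega>) (A (Suc m)) \<partial>C 0 m ?u)"
      using emeasure_bind[OF ne, of "eP m" "PiM {0..<Suc m} (\<lambda>_. count_space UNIV)" "A (Suc m)"]
        measurable_eP[of m] A_sets[of "Suc m"]
      by (simp add: measurable_cong_sets[OF st refl])
    also have "\<dots> = (\<integral>\<^sup>+\<omega>. c m * indicator (A m) \<omega> \<partial>C 0 m ?u)"
      by (intro nn_integral_cong step) (simp add: sp)
    also have "\<dots> = c m * emeasure (C 0 m ?u) (A m)"
      by (intro nn_integral_cmult_indicator) (simp add: st)
    finally show ?case
      using Suc.IH by (simp add: mult.commute)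
  qed
  have "{\<omega>. \<forall>i\<le>n. \<omega> i = x i} = PF.emb UNIV {0..<Suc n} (A (Suc n))"
    by (auto simp: A_def prod_emb_def space_PiM PiE_iff less_Suc_eq_le)
  then have "emeasure PF.lim {\<omega>. \<forall>i\<le>n. \<omega> i = x i} = emeasure (CI {0..<Suc n}) (A (Suc n))"
    using lim[of "{0..<Suc n}" "A (Suc n)"] A_sets[of "Suc n"] by simp
  also have "\<dots> = emeasure (C 0 (Suc n) ?u) (A (Suc n))"
  proof -
    have "PF.emb {0..<Suc n} {0..<Suc n} (A (Suc n)) = A (Suc n)"
      using sets.sets_into_space[OF A_sets[of "Suc n"]] by (intro prod_emb_id) (simp add: space_PiM)
    then show ?thesis
      using emeasure_CI[of "{0..<Suc n}" "Suc n" "A (Suc n)"] A_sets[of "Suc n"] by simp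
  qed
  also have "\<dots> = (\<Prod>i<Suc n. c i)"
    by (rule C_A)
  also have "\<dots> = c 0 * (\<Prod>i<n. c (Suc i))"
    by (rule prod.lessThan_Suc_shift)
  also have "(\<Prod>i<n. c (Suc i)) = ennreal (\<Prod>i<n. pmf (rw_step V E (x i)) (x (Suc i)))"
    by (simp add: c_def prod_ennreal)
  finally show ?thesis
    unfolding rw_measure_def by (simp add: c_def)
qed

definition hit_time :: "nat \<Rightarrow> (nat \<Rightarrow> nat) \<Rightarrow> ennreal" where
  "hit_time w \<omega> = (INF n\<in>{n. \<omega> n = w}. of_nat n)"

definition exp_hit :: "nat set \<Rightarrow> nat set set \<Rightarrow> nat \<Rightarrow> nat \<Rightarrow> ennreal" where
  "exp_hit V E v w = (\<integral>\<^sup>+\<omega>. hit_time w \<omega> \<partial>rw_measure V E v)"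

text \<open>Hitting times may be infinite, so \<open>stat_hit\<close> is meaningful for every realization and
  connectedness need not be assumed.\<close>

definition stat_hit :: "nat set \<Rightarrow> nat set set \<Rightarrow> nat \<Rightarrow> ennreal" where
  "stat_hit V E w = (\<Sum>v\<in>V. ennreal (inv_dist V E v) * exp_hit V E v w)"


subsection \<open>Asymptotics\<close>

definition multiples_at_top :: "nat \<Rightarrow> nat filter" where
  "multiples_at_top M = inf at_top (principal {N. M dvd N})"

text \<open>Division by zero yields zero in \<^typ>\<open>real\<close>, so the quotient is required to be well defined
  explicitly.\<close>

definition quot_tendsto_0 :: "nat filter \<Rightarrow> (nat \<Rightarrow> real) \<Rightarrow> (nat \<Rightarrow> real) \<Rightarrow> bool" where
  "quot_tendsto_0 F a b \<longleftrightarrow>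
     (\<forall>\<^sub>F N in F. b N \<noteq> 0) \<and> ((\<lambda>N. a N / b N) \<longlongrightarrow> 0) F"

definition aas :: "nat filter \<Rightarrow> (nat \<Rightarrow> 'a pmf) \<Rightarrow> (nat \<Rightarrow> 'a \<Rightarrow> bool) \<Rightarrow> bool" where
  "aas F \<mu> A \<longleftrightarrow> ((\<lambda>N. measure_pmf.prob (\<mu> N) {x. A N x}) \<longlongrightarrow> 1) F"

definition aas_asymp ::
    "nat filter \<Rightarrow> (nat \<Rightarrow> 'a pmf) \<Rightarrow> (nat \<Rightarrow> 'a \<Rightarrow> ennreal) \<Rightarrow> (nat \<Rightarrow> real) \<Rightarrow> bool" where
  "aas_asymp F \<mu> X x \<longleftrightarrow>
     (\<exists>\<delta> :: nat \<Rightarrow> real. (\<delta> \<longlongrightarrow> 0) F \<and>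
        aas F \<mu> (\<lambda>N \<omega>. \<bar>enn2ereal (X N \<omega>) / ereal (x N) - 1\<bar> \<le> ereal (\<delta> N)))"

end

theory Submission
  imports Defs "HOL-Real_Asymp.Real_Asymp"
begin

text \<open>Let \<open>h v = H\<^sub>v\<^sub>w\<close> and \<open>vol = \<Sum>\<^sub>v d\<^sub>v\<close>. First-step analysis says that \<open>h\<close> vanishes at \<open>w\<close> and has
  Laplacian \<open>d\<close> elsewhere, so its Dirichlet energy is \<open>vol \<cdot> H\<^sub>w\<close>, and \<open>H\<^sub>w\<close> is controlled by test
  functions and flows. The part of the energy carried by the edges at \<open>w\<close> gives
  \<open>H\<^sub>w \<ge> (1 - \<pi>\<^sub>w)\<^sup>2 / \<pi>\<^sub>w\<close>. For the upper bound, \<open>\<pi>\<close> is compared with the uniform distribution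
  on the neighbours of \<open>w\<close>. Transporting mass from \<open>w\<close> to its neighbours costs the main term
  \<open>1 / \<pi>\<^sub>w\<close>, and the remaining correction has squared norm of order \<open>1 / d\<^sub>w\<close>, hence is negligible as
  soon as the algebraic connectivity of the graph tends to infinity. By Cheeger's inequality the
  latter is at least \<open>\<phi>\<^sup>2 / (2 \<Delta>)\<close>, where \<open>\<Delta>\<close> is the maximal degree and \<open>\<phi>\<close> the edge expansion.

  A Chernoff bound with a union bound over vertices and over vertex sets shows that all degrees are
  close to \<open>d = N (p + (M - 1) q) / M\<close> and that \<open>\<phi>\<close> is at least a quarter of
  \<open>\<psi> = N (M - 1) q / M\<close> (of \<open>N p\<close> if \<open>M = 1\<close>). The hypothesis on \<open>q\<close> says precisely that \<open>\<psi>\<^sup>2 / d\<close> exceeds \<open>log N\<close> in order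
  when intra-block edges dominate.\<close>

subsection \<open>Weighted graphs: edge expansion and Dirichlet energy\<close>

locale weighted_graph =
  fixes V :: "'a set" and a :: "'a \<Rightarrow> 'a \<Rightarrow> real"
  assumes finite_V: "finite V"
    and a_sym: "a u v = a v u"
    and a_nonneg: "0 \<le> a u v"
begin

definition degree :: "'a \<Rightarrow> real" where
  "degree v = (\<Sum>u\<in>V. a v u)"

definition vol :: real where
  "vol = (\<Sum>v\<in>V. degree v)"

text \<open>The sum runs over ordered pairs, so every edge between distinct vertices enters twice
  and the value is twice the usual Dirichlet form.\<close>

definition energy :: "('a \<Rightarrow> real) \<Rightarrow> real" where
  "energy f = (\<Sum>u\<in>V. \<Sum>v\<in>V. a u v * (f u - f v)\<^sup>2)"

definition cut :: "'a set \<Rightarrow> real" where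
  "cut S = (\<Sum>u\<in>S. \<Sum>v\<in>V - S. a u v)"

text \<open>The boundary is measured against the number of vertices rather than the volume; the
  maximal degree therefore enters separately in the resulting spectral gap.\<close>

definition expansion :: "real \<Rightarrow> bool" where
  "expansion \<phi> \<longleftrightarrow> (\<forall>S\<subseteq>V. S \<noteq> {} \<longrightarrow> 2 * card S \<le> card V \<longrightarrow> \<phi> * card S \<le> cut S)"

lemma degree_nonneg: "0 \<le> degree v"
  by (simp add: degree_def sum_nonneg a_nonneg)

lemma energy_nonneg: "0 \<le> energy f"
  by (simp add: energy_def sum_nonneg a_nonneg)

lemma sum_a_swap: "(\<Sum>u\<in>V. \<Sum>v\<in>V. a u v * f v u) = (\<Sum>u\<in>V. \<Sum>v\<in>V. a u v * f u v)"
proof -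
  have "(\<Sum>u\<in>V. \<Sum>v\<in>V. a u v * f v u) = (\<Sum>v\<in>V. \<Sum>u\<in>V. a u v * f v u)"
    by (rule sum.swap)
  also have "\<dots> = (\<Sum>v\<in>V. \<Sum>u\<in>V. a v u * f v u)"
    by (simp add: a_sym)
  finally show ?thesis .
qed

lemma sum_a_const: "(\<Sum>u\<in>V. \<Sum>v\<in>V. a u v * f u) = (\<Sum>u\<in>V. degree u * f u)"
  by (simp add: degree_def sum_distrib_right)

lemma sum_a_const': "(\<Sum>u\<in>V. \<Sum>v\<in>V. a u v * f v) = (\<Sum>u\<in>V. degree u * f u)"
  using sum_a_swap[of "\<lambda>u v. f u"] sum_a_const[of f] by simp

section \<open>Cheeger's inequality\<close>

lemma cut_variation:
  assumes "S \<subseteq> V"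
  shows "(\<Sum>u\<in>V. \<Sum>v\<in>V. a u v * \<bar>indicator S u - indicator S v\<bar>) = 2 * cut S"
proof -
  have S: "V \<inter> S = S" "V \<inter> - S = V - S"
    using assms by auto
  have "(\<Sum>u\<in>V. \<Sum>v\<in>V. a u v * \<bar>indicator S u - indicator S v\<bar>)
      = (\<Sum>u\<in>V. \<Sum>v\<in>V. a u v * (indicator S u * indicator (V - S) v))
        + (\<Sum>u\<in>V. \<Sum>v\<in>V. a u v * (indicator S v * indicator (V - S) u))"
    unfolding sum.distrib[symmetric]
    by (intro sum.cong refl) (auto simp: indicator_def)
  also have "\<dots> = 2 * (\<Sum>u\<in>V. \<Sum>v\<in>V. a u v * (indicator S u * indicator (V - S) v))"
    using sum_a_swap[of "\<lambda>u v. indicator S u * indicator (V - S) v"] by simp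
  also have "(\<Sum>u\<in>V. \<Sum>v\<in>V. a u v * (indicator S u * indicator (V - S) v))
      = (\<Sum>u\<in>V. indicator S u * (\<Sum>v\<in>V. indicator (V - S) v * a u v))"
    by (simp add: sum_distrib_left mult_ac)
  also have "\<dots> = cut S"
    unfolding cut_def using assms finite_V
    by (simp add: sum.If_cases indicator_def if_distrib[of "\<lambda>x. x * _"] S cong: if_cong)
      (simp add: Int_absorb1 Diff_eq Compl_eq)
  finally show ?thesis
    by simp
qed

text \<open>Coarea argument: \<open>h\<close> is a positive combination of indicators of its
  superlevel sets, each contained in the support and hence small enough for
  \<open>expansion\<close>. The induction peels off the lowest layer. The factor 2 comes from
  meeting each boundary edge in both orders.\<close>

lemma expansion_L1:
  assumes "expansion \<phi>" "\<And>v. v \<in> V \<Longrightarrow> 0 \<le> h v" "2 * card {v\<in>V. 0 < h v} \<le> card V"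
  shows "2 * \<phi> * (\<Sum>v\<in>V. h v) \<le> (\<Sum>u\<in>V. \<Sum>v\<in>V. a u v * \<bar>h u - h v\<bar>)"
  using assms(2,3)
proof (induction "card {v\<in>V. 0 < h v}" arbitrary: h rule: less_induct)
  case less
  define S where "S = {v\<in>V. 0 < h v}"
  have SV: "S \<subseteq> V" and fS: "finite S"
    using finite_V by (auto simp: S_def)
  show ?case
  proof (cases "S = {}")
    case True
    then have "h v = 0" if "v \<in> V" for v
      using less.prems(1)[OF that] that by (force simp: S_def)
    then show ?thesis
      by simp
  next
    case False
    define m where "m = Min (h ` S)"
    have m_in: "m \<in> h ` S" and m_le: "\<And>v. v \<in> S \<Longrightarrow> m \<le> h v"
      using False fS by (auto simp: m_def)
    have m_pos: "0 < m"
      using m_in by (auto simp: S_def)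
    \<comment> \<open>Lowering \<open>h\<close> by its least positive value makes the minimisers
      vanish, so the support shrinks strictly.\<close>
    define h' where "h' v = h v - m * indicator S v" for v
    have h0: "h v = 0" if "v \<in> V" "v \<notin> S" for v
      using less.prems(1)[OF that(1)] that by (force simp: S_def)
    have h'_nn: "0 \<le> h' v" if "v \<in> V" for v
      using that m_le[of v] h0[of v] by (cases "v \<in> S") (auto simp: h'_def)
    have sub: "{v\<in>V. 0 < h' v} \<subset> S"
    proof -
      obtain x where "x \<in> S" "h x = m"
        using m_in by auto
      then have "x \<notin> {v\<in>V. 0 < h' v}"
        by (simp add: h'_def)
      moreover have "{v\<in>V. 0 < h' v} \<subseteq> S"
        by (auto simp: h'_def S_def indicator_def split: if_splits)
      ultimately show ?thesis
        using \<open>x \<in> S\<close> by blast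
    qed
    then have card_less: "card {v\<in>V. 0 < h' v} < card S"
      using fS by (rule psubset_card_mono[rotated])
    have IH: "2 * \<phi> * (\<Sum>v\<in>V. h' v) \<le> (\<Sum>u\<in>V. \<Sum>v\<in>V. a u v * \<bar>h' u - h' v\<bar>)"
      using less.hyps[of h'] card_less less.prems(2) h'_nn unfolding S_def by simp
    have "2 * card S \<le> card V"
      using less.prems(2) by (simp add: S_def)
    then have cutS: "\<phi> * card S \<le> cut S"
      using assms(1) False SV by (auto simp: expansion_def)
    \<comment> \<open>No cancellation occurs: across the boundary of \<open>S\<close> the increments
      of \<open>h'\<close> and of the indicator never have opposite signs, and elsewhere the latter
      is zero.\<close>
    have split: "\<bar>h u - h v\<bar> = \<bar>h' u - h' v\<bar> + m * \<bar>indicator S u - indicator S v\<bar>"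
      if "u \<in> V" "v \<in> V" for u v
      using m_le[of u] m_le[of v] h0[of u] h0[of v] m_pos that
      by (auto simp: h'_def indicator_def)
    have "(\<Sum>v\<in>V. indicator S v) = real (card S)"
      using SV finite_V by (simp add: indicator_def Int_absorb1)
    then have "(\<Sum>v\<in>V. h v) = (\<Sum>v\<in>V. h' v) + m * card S"
      by (simp add: h'_def sum_subtractf sum_distrib_left[symmetric])
    then have "2 * \<phi> * (\<Sum>v\<in>V. h v) = 2 * \<phi> * (\<Sum>v\<in>V. h' v) + 2 * m * (\<phi> * card S)"
      by (simp add: algebra_simps)
    also have "\<dots> \<le> (\<Sum>u\<in>V. \<Sum>v\<in>V. a u v * \<bar>h' u - h' v\<bar>) + 2 * m * cut S"
      using IH cutS m_pos by (intro add_mono mult_left_mono) auto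
    also have "2 * m * cut S = m * (\<Sum>u\<in>V. \<Sum>v\<in>V. a u v * \<bar>indicator S u - indicator S v\<bar>)"
      by (simp add: cut_variation[OF SV])
    also have "(\<Sum>u\<in>V. \<Sum>v\<in>V. a u v * \<bar>h' u - h' v\<bar>) + \<dots>
        = (\<Sum>u\<in>V. \<Sum>v\<in>V. a u v * \<bar>h u - h v\<bar>)"
      by (simp add: split sum_distrib_left sum.distrib algebra_simps)
    finally show ?thesis .
  qed
qed

lemma cauchy_schwarz_edges:
  "(\<Sum>u\<in>V. \<Sum>v\<in>V. a u v * (f u v * g u v))\<^sup>2
    \<le> (\<Sum>u\<in>V. \<Sum>v\<in>V. a u v * (f u v)\<^sup>2) * (\<Sum>u\<in>V. \<Sum>v\<in>V. a u v * (g u v)\<^sup>2)"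
proof -
  let ?F = "\<lambda>(u, v). sqrt (a u v) * f u v" and ?G = "\<lambda>(u, v). sqrt (a u v) * g u v"
  have "(\<Sum>x\<in>V \<times> V. ?F x * ?G x)\<^sup>2 \<le> (\<Sum>x\<in>V \<times> V. (?F x)\<^sup>2) * (\<Sum>x\<in>V \<times> V. (?G x)\<^sup>2)"
    by (rule Cauchy_Schwarz_ineq_sum)
  moreover have "sqrt (a u v) * x * (sqrt (a u v) * y) = a u v * (x * y)" for u v x y
    using a_nonneg[of u v] by (metis mult.assoc mult.left_commute real_sqrt_mult_self abs_of_nonneg)
  moreover have "(sqrt (a u v) * x)\<^sup>2 = a u v * x\<^sup>2" for u v x
    using a_nonneg[of u v] by (simp add: power_mult_distrib)
  ultimately show ?thesis
    by (simp add: sum.cartesian_product split_def)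
qed

text \<open>Apply the L1 bound to the square of \<open>f\<close>, factor each difference of squares
  and use Cauchy-Schwarz. The sums \<open>f u + f v\<close> contribute at most 4
  \<open>\<Delta>\<close> times the sum of squares, one copy of which is then cancelled.\<close>

lemma expansion_L2:
  assumes "expansion \<phi>" "0 \<le> \<phi>" "\<And>v. v \<in> V \<Longrightarrow> degree v \<le> \<Delta>"
    and "\<And>v. v \<in> V \<Longrightarrow> 0 \<le> f v" "2 * card {v\<in>V. 0 < f v} \<le> card V"
  shows "\<phi>\<^sup>2 * (\<Sum>v\<in>V. (f v)\<^sup>2) \<le> \<Delta> * energy f"
proof (cases "(\<Sum>v\<in>V. (f v)\<^sup>2) = 0")
  case True
  have "0 \<le> \<Delta> * energy f"
  proof (cases "V = {}")
    case False
    then show ?thesis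
      using assms(3) degree_nonneg energy_nonneg by (metis all_not_in_conv mult_nonneg_nonneg order_trans)
  next
    case True
    then have "energy f = 0"
      unfolding energy_def by simp
    then show ?thesis
      by simp
  qed
  then show ?thesis
    using True by simp
next
  case False
  define s where "s = (\<Sum>v\<in>V. (f v)\<^sup>2)"
  have s_pos: "0 < s"
    using False sum_nonneg[of V "\<lambda>v. (f v)\<^sup>2"] by (simp add: s_def less_le)
  have "{v\<in>V. 0 < (f v)\<^sup>2} = {v\<in>V. 0 < f v}"
    using assms(4) by force
  then have "2 * \<phi> * s \<le> (\<Sum>u\<in>V. \<Sum>v\<in>V. a u v * \<bar>(f u)\<^sup>2 - (f v)\<^sup>2\<bar>)"
    unfolding s_def using assms(5) by (intro expansion_L1 assms(1)) auto
  also have "\<dots> = (\<Sum>u\<in>V. \<Sum>v\<in>V. a u v * (\<bar>f u - f v\<bar> * (f u + f v)))"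
  proof (intro sum.cong refl)
    fix u v assume "u \<in> V" "v \<in> V"
    then have "0 \<le> f u + f v"
      using assms(4) by simp
    moreover have "(f u)\<^sup>2 - (f v)\<^sup>2 = (f u - f v) * (f u + f v)"
      by (simp add: power2_eq_square algebra_simps)
    then have "\<bar>(f u)\<^sup>2 - (f v)\<^sup>2\<bar> = \<bar>f u - f v\<bar> * \<bar>f u + f v\<bar>"
      by (simp only: abs_mult)
    ultimately show "a u v * \<bar>(f u)\<^sup>2 - (f v)\<^sup>2\<bar> = a u v * (\<bar>f u - f v\<bar> * (f u + f v))"
      by simp
  qed
  finally have "(2 * \<phi> * s)\<^sup>2 \<le> (\<Sum>u\<in>V. \<Sum>v\<in>V. a u v * (\<bar>f u - f v\<bar> * (f u + f v)))\<^sup>2"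
    using assms(2) s_pos by (intro power_mono) auto
  also have "\<dots> \<le> energy f * (\<Sum>u\<in>V. \<Sum>v\<in>V. a u v * (f u + f v)\<^sup>2)"
    using cauchy_schwarz_edges[of "\<lambda>u v. \<bar>f u - f v\<bar>" "\<lambda>u v. f u + f v"] by (simp add: energy_def)
  also have "\<dots> \<le> energy f * (4 * \<Delta> * s)"
  proof (intro mult_left_mono energy_nonneg)
    have "(\<Sum>u\<in>V. \<Sum>v\<in>V. a u v * (f u + f v)\<^sup>2) \<le> (\<Sum>u\<in>V. \<Sum>v\<in>V. a u v * (2 * (f u)\<^sup>2) + a u v * (2 * (f v)\<^sup>2))"
    proof (intro sum_mono)
      fix u v
      have "(f u + f v)\<^sup>2 \<le> 2 * (f u)\<^sup>2 + 2 * (f v)\<^sup>2"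
        using zero_le_power2[of "f u - f v"] by (simp add: power2_eq_square algebra_simps)
      then show "a u v * (f u + f v)\<^sup>2 \<le> a u v * (2 * (f u)\<^sup>2) + a u v * (2 * (f v)\<^sup>2)"
        using a_nonneg[of u v] by (metis distrib_left mult_left_mono)
    qed
    also have "\<dots> = 4 * (\<Sum>u\<in>V. degree u * (f u)\<^sup>2)"
      by (simp only: sum.distrib sum_a_const sum_a_const') (simp add: sum_distrib_left algebra_simps)
    also have "\<dots> \<le> 4 * (\<Sum>u\<in>V. \<Delta> * (f u)\<^sup>2)"
      by (intro mult_left_mono sum_mono mult_right_mono assms(3)) auto
    finally show "(\<Sum>u\<in>V. \<Sum>v\<in>V. a u v * (f u + f v)\<^sup>2) \<le> 4 * \<Delta> * s"
      by (simp add: s_def sum_distrib_left mult_ac)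
  qed
  finally have "(4 * s) * (\<phi>\<^sup>2 * s) \<le> (4 * s) * (\<Delta> * energy f)"
    by (simp add: power2_eq_square mult_ac)
  then show ?thesis
    using s_pos by (simp add: s_def)
qed

end

text \<open>The least attained value with at most half of the elements strictly above it works: if
  some value lies below, the next lower attained value fails the condition, so more than half of the
  elements are at or above the chosen one.\<close>

lemma ex_median:
  fixes g :: "'a \<Rightarrow> 'b :: linorder"
  assumes "finite V"
  shows "\<exists>m. 2 * card {v\<in>V. m < g v} \<le> card V \<and> 2 * card {v\<in>V. g v < m} \<le> card V"
proof (cases "V = {}")
  case False
  define T where "T = {m \<in> g ` V. 2 * card {v\<in>V. m < g v} \<le> card V}"
  have fT: "finite T"
    using assms by (simp add: T_def)
  have "\<not> Max (g ` V) < g v" if "v \<in> V" for v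
    using assms that by (simp add: not_less)
  then have "{v\<in>V. Max (g ` V) < g v} = {}"
    by blast
  moreover have "Max (g ` V) \<in> g ` V"
    using assms False by (intro Max_in) auto
  ultimately have "Max (g ` V) \<in> T"
    unfolding T_def by (simp del: Max_less_iff Collect_empty_eq)
  then have "T \<noteq> {}"
    by auto
  define m where "m = Min T"
  have mT: "m \<in> T" and m_least: "\<And>x. x \<in> T \<Longrightarrow> m \<le> x"
    using fT \<open>T \<noteq> {}\<close> by (auto simp: m_def)
  have "2 * card {v\<in>V. g v < m} \<le> card V"
  proof (cases "{v\<in>V. g v < m} = {}")
    case nonempty: False
    define x where "x = Max (g ` {v\<in>V. g v < m})"
    have x_in: "x \<in> g ` {v\<in>V. g v < m}"
      unfolding x_def using nonempty assms by (intro Max_in) auto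
    have x_ge: "g v \<le> x" if "v \<in> V" "g v < m" for v
      unfolding x_def using that assms by (intro Max_ge) auto
    have "x \<notin> T"
      using x_in m_least by (auto simp: not_le[symmetric])
    then have "card V < 2 * card {v\<in>V. x < g v}"
      using x_in by (auto simp: T_def)
    moreover have "card {v\<in>V. g v < m} + card {v\<in>V. x < g v} \<le> card V"
    proof -
      have "card {v\<in>V. g v < m} + card {v\<in>V. x < g v} = card ({v\<in>V. g v < m} \<union> {v\<in>V. x < g v})"
      proof (intro card_Un_disjoint[symmetric])
        show "{v\<in>V. g v < m} \<inter> {v\<in>V. x < g v} = {}"
          using x_ge leD by blast
      qed (use assms in auto)
      also have "\<dots> \<le> card V"
        using assms by (intro card_mono) auto
      finally show ?thesis .
    qed
    ultimately show ?thesis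
      by linarith
  next
    case True
    then show ?thesis
      by (simp only: card.empty)
  qed
  then show ?thesis
    using mT by (auto simp: T_def)
qed simp

context weighted_graph
begin

text \<open>Centring at a median makes the positive and the negative part each live on at most half
  of the vertices, as \<open>expansion_L2\<close> demands.\<close>

lemma expansion_poincare:
  assumes "expansion \<phi>" "0 \<le> \<phi>" "\<And>v. v \<in> V \<Longrightarrow> degree v \<le> \<Delta>" "0 \<le> \<Delta>"
  shows "\<exists>m. \<phi>\<^sup>2 * (\<Sum>v\<in>V. (g v - m)\<^sup>2) \<le> \<Delta> * energy g"
proof -
  obtain m where m: "2 * card {v\<in>V. m < g v} \<le> card V" "2 * card {v\<in>V. g v < m} \<le> card V"
    using ex_median[OF finite_V, of g] by auto
  define P where "P v = max 0 (g v - m)" for v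
  define Q where "Q v = max 0 (m - g v)" for v
  have "\<phi>\<^sup>2 * (\<Sum>v\<in>V. (P v)\<^sup>2) \<le> \<Delta> * energy P"
    using m by (intro expansion_L2[OF assms(1-3)]) (auto simp: P_def less_max_iff_disj)
  moreover have "\<phi>\<^sup>2 * (\<Sum>v\<in>V. (Q v)\<^sup>2) \<le> \<Delta> * energy Q"
    using m by (intro expansion_L2[OF assms(1-3)]) (auto simp: Q_def less_max_iff_disj)
  moreover have "(\<Sum>v\<in>V. (g v - m)\<^sup>2) = (\<Sum>v\<in>V. (P v)\<^sup>2) + (\<Sum>v\<in>V. (Q v)\<^sup>2)"
    unfolding sum.distrib[symmetric]
    by (intro sum.cong refl) (auto simp: P_def Q_def max_def power2_commute)
  moreover have "energy P + energy Q \<le> energy g"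
    unfolding energy_def sum.distrib[symmetric] distrib_left[symmetric]
  proof (intro sum_mono mult_left_mono a_nonneg)
    fix u v
    have eq: "g u - g v = (P u - P v) - (Q u - Q v)"
      by (auto simp: P_def Q_def max_def)
    \<comment> \<open>\<open>P\<close> is nondecreasing and \<open>Q\<close> nonincreasing in
      \<open>g\<close>, so the cross term in the square of the difference is nonnegative and may be
      dropped.\<close>
    have "(P u - P v) * (Q u - Q v) \<le> 0"
      by (auto simp: P_def Q_def max_def mult_le_0_iff)
    then show "(P u - P v)\<^sup>2 + (Q u - Q v)\<^sup>2 \<le> (g u - g v)\<^sup>2"
      unfolding eq power2_diff[of "P u - P v"] by (simp only: mult.assoc)
  qed
  then have "\<Delta> * (energy P + energy Q) \<le> \<Delta> * energy g"
    using assms(4) by (rule mult_left_mono)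
  ultimately have "\<phi>\<^sup>2 * (\<Sum>v\<in>V. (g v - m)\<^sup>2) \<le> \<Delta> * energy g"
    by (simp add: distrib_left)
  then show ?thesis ..
qed

section \<open>Green's identity and bounds for the averaged potential\<close>

lemma energy_eq_laplacian:
  "energy h = 2 * (\<Sum>v\<in>V. h v * (degree v * h v - (\<Sum>u\<in>V. a v u * h u)))"
proof -
  have "energy h = (\<Sum>u\<in>V. \<Sum>v\<in>V. a u v * (h u)\<^sup>2) + (\<Sum>u\<in>V. \<Sum>v\<in>V. a u v * (h v)\<^sup>2)
      - 2 * (\<Sum>u\<in>V. \<Sum>v\<in>V. a u v * (h u * h v))"
    by (simp add: energy_def power2_diff algebra_simps sum.distrib sum_subtractf sum_distrib_left)
  also have "\<dots> = 2 * (\<Sum>u\<in>V. degree u * (h u)\<^sup>2) - 2 * (\<Sum>u\<in>V. \<Sum>v\<in>V. a u v * (h u * h v))"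
    by (simp only: sum_a_const sum_a_const')
  also have "\<dots> = 2 * (\<Sum>v\<in>V. h v * (degree v * h v - (\<Sum>u\<in>V. a v u * h u)))"
    by (simp add: right_diff_distrib sum_subtractf sum_distrib_left power2_eq_square mult_ac)
  finally show ?thesis .
qed

text \<open>Only the edges at \<open>w\<close> are kept. They occur once in row \<open>w\<close> and
  once in column \<open>w\<close>, hence the factor 2; a loop at \<open>w\<close> contributes
  nothing.\<close>

lemma energy_ge_star:
  assumes "w \<in> V" "h w = 0"
  shows "2 * (\<Sum>u\<in>V. a w u * (h u)\<^sup>2) \<le> energy h"
proof -
  let ?F = "\<lambda>u. \<Sum>v\<in>V. a u v * (h u - h v)\<^sup>2"
  have "energy h = ?F w + (\<Sum>u\<in>V - {w}. ?F u)"
    unfolding energy_def using assms(1) finite_V by (rule sum.remove[rotated])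
  moreover have "?F w = (\<Sum>u\<in>V. a w u * (h u)\<^sup>2)"
    using assms(2) by simp
  moreover have "(\<Sum>u\<in>V. a w u * (h u)\<^sup>2) = (\<Sum>u\<in>V - {w}. a w u * (h u)\<^sup>2)"
    using assms finite_V by (subst sum.remove[of V w]) auto
  moreover have "\<dots> \<le> (\<Sum>u\<in>V - {w}. ?F u)"
  proof (intro sum_mono)
    fix u
    have "a u w * (h u - h w)\<^sup>2 \<le> ?F u"
      using assms(1) finite_V by (intro member_le_sum) (auto simp: a_nonneg)
    then show "a w u * (h u)\<^sup>2 \<le> ?F u"
      using assms(2) by (simp add: a_sym)
  qed
  ultimately show ?thesis
    by linarith
qed

lemma star_sum_sq_le:
  "(\<Sum>u\<in>V. a w u * h u)\<^sup>2 \<le> degree w * (\<Sum>u\<in>V. a w u * (h u)\<^sup>2)"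
proof -
  have "(\<Sum>u\<in>V. sqrt (a w u) * (sqrt (a w u) * h u))\<^sup>2
      \<le> (\<Sum>u\<in>V. (sqrt (a w u))\<^sup>2) * (\<Sum>u\<in>V. (sqrt (a w u) * h u)\<^sup>2)"
    by (rule Cauchy_Schwarz_ineq_sum)
  then show ?thesis
    by (simp add: degree_def a_nonneg power_mult_distrib mult.assoc[symmetric])
qed

text \<open>The Laplacian is only bounded from above because the estimate is meant for truncated
  hitting times, before finiteness is known. The average \<open>D / vol\<close> splits into the mean
  over the neighbours of \<open>w\<close> and a correction; both are at most a multiple of
  \<open>sqrt (D / degree w)\<close>, so the estimate closes on itself.\<close>

lemma supersolution_upper_bound:
  assumes "expansion \<phi>" "0 < \<phi>" "\<And>v. v \<in> V \<Longrightarrow> degree v \<le> \<Delta>"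
    and "w \<in> V" "0 < degree w" "\<And>u. u \<in> V \<Longrightarrow> a w u \<le> 1"
    and "\<And>v. v \<in> V \<Longrightarrow> 0 \<le> h v" "h w = 0"
    and "\<And>v. v \<in> V \<Longrightarrow> v \<noteq> w \<Longrightarrow> degree v * h v - (\<Sum>u\<in>V. a v u * h u) \<le> degree v"
  shows "(\<Sum>v\<in>V. degree v / vol * h v)
    \<le> vol / degree w * (1 + sqrt ((1 + degree w * \<Delta> / vol) * (2 * \<Delta>)) / \<phi>)\<^sup>2"
proof -
  define D where "D = (\<Sum>v\<in>V. degree v * h v)"
  \<comment> \<open>The signed difference between the stationary distribution and the one-step
    distribution from \<open>w\<close>. Its total mass is zero, so the constant \<open>m\<close> of
    the Poincare inequality can be subtracted from \<open>h\<close> for free.\<close>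
  define r where "r v = degree v / vol - a w v / degree w" for v
  have \<Delta>_pos: "0 < \<Delta>"
    using assms(3-5) by force
  have "degree w \<le> vol"
    unfolding vol_def using assms(4) finite_V degree_nonneg by (intro member_le_sum) auto
  then have vol_pos: "0 < vol"
    using assms(5) by simp
  have D_nn: "0 \<le> D"
    unfolding D_def using degree_nonneg assms(7) by (intro sum_nonneg) auto
  have E_le: "energy h \<le> 2 * D"
    unfolding energy_eq_laplacian D_def
  proof (intro mult_left_mono sum_mono)
    fix v assume "v \<in> V"
    then show "h v * (degree v * h v - (\<Sum>u\<in>V. a v u * h u)) \<le> degree v * h v"
      using assms(7)[of v] assms(8) mult_left_mono[OF assms(9)[of v] assms(7)[of v]]
      by (cases "v = w") (auto simp: mult_ac)
  qed simp
  obtain m where "\<phi>\<^sup>2 * (\<Sum>v\<in>V. (h v - m)\<^sup>2) \<le> \<Delta> * energy h"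
    using expansion_poincare[OF assms(1) _ assms(3), of h] assms(2) \<Delta>_pos by auto
  also have "\<dots> \<le> \<Delta> * (2 * D)"
    using E_le \<Delta>_pos by simp
  finally have var: "(\<Sum>v\<in>V. (h v - m)\<^sup>2) \<le> 2 * \<Delta> * D / \<phi>\<^sup>2"
    using assms(2) by (simp add: field_simps)
  have a_deg: "(\<Sum>v\<in>V. a w v) = degree w"
    by (simp add: degree_def)
  have deg_vol: "(\<Sum>v\<in>V. degree v) = vol"
    by (simp add: vol_def)
  \<comment> \<open>The cross term has a favourable sign. In each remaining square one factor is
    replaced by its bound, \<open>\<Delta>\<close> or 1, and the other sums to \<open>vol\<close> or
    \<open>degree w\<close>.\<close>
  have r_sq: "(\<Sum>v\<in>V. (r v)\<^sup>2) \<le> (1 + degree w * \<Delta> / vol) / degree w"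
  proof -
    have "(\<Sum>v\<in>V. (r v)\<^sup>2) \<le> (\<Sum>v\<in>V. \<Delta> / vol\<^sup>2 * degree v + a w v / (degree w)\<^sup>2)"
    proof (intro sum_mono)
      fix v assume v: "v \<in> V"
      define x where "x = degree v / vol"
      define y where "y = a w v / degree w"
      have "0 \<le> x * y"
        unfolding x_def y_def using degree_nonneg a_nonneg vol_pos by simp
      then have "(r v)\<^sup>2 \<le> x\<^sup>2 + y\<^sup>2"
        by (simp add: r_def x_def[symmetric] y_def[symmetric] power2_diff)
      also have "x\<^sup>2 \<le> \<Delta> / vol\<^sup>2 * degree v"
        using mult_right_mono[OF assms(3)[OF v] degree_nonneg[of v]] vol_pos
        by (simp add: x_def power_divide divide_right_mono power2_eq_square)
      also have "y\<^sup>2 \<le> a w v / (degree w)\<^sup>2"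
        using mult_right_mono[OF assms(6)[OF v] a_nonneg[of w v]]
        by (simp add: y_def power_divide divide_right_mono power2_eq_square)
      finally show "(r v)\<^sup>2 \<le> \<Delta> / vol\<^sup>2 * degree v + a w v / (degree w)\<^sup>2"
        by simp
    qed
    also have "\<dots> = \<Delta> / vol\<^sup>2 * vol + degree w / (degree w)\<^sup>2"
      by (simp only: sum.distrib sum_distrib_left[symmetric] sum_divide_distrib[symmetric]
          a_deg deg_vol)
    also have "\<dots> = (1 + degree w * \<Delta> / vol) / degree w"
      using vol_pos assms(5) by (simp add: field_simps power2_eq_square)
    finally show ?thesis .
  qed
  \<comment> \<open>Cauchy-Schwarz on the star at \<open>w\<close>, combined with the star's share
    of at most half of \<open>energy h\<close>, that is, at most \<open>D\<close>.\<close>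
  have first: "(\<Sum>u\<in>V. a w u * h u) / degree w \<le> sqrt (D / degree w)"
  proof -
    have "(\<Sum>u\<in>V. a w u * h u)\<^sup>2 \<le> degree w * D"
    proof -
      have "(\<Sum>u\<in>V. a w u * (h u)\<^sup>2) \<le> D"
        using energy_ge_star[of w h] assms(4,8) E_le by simp
      then show ?thesis
        using star_sum_sq_le[of w h] assms(5) by (meson mult_le_cancel_left_pos order_trans)
    qed
    then have "((\<Sum>u\<in>V. a w u * h u) / degree w)\<^sup>2 \<le> D / degree w"
      using assms(5) by (simp add: power_divide power2_eq_square field_simps)
    then show ?thesis
      by (rule real_le_rsqrt)
  qed
  define c where "c = sqrt ((1 + degree w * \<Delta> / vol) * (2 * \<Delta>)) / \<phi>"
  have second: "(\<Sum>v\<in>V. r v * (h v - m)) \<le> sqrt (D / degree w) * c"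
  proof -
    have "(\<Sum>v\<in>V. r v * (h v - m))\<^sup>2 \<le> (\<Sum>v\<in>V. (r v)\<^sup>2) * (\<Sum>v\<in>V. (h v - m)\<^sup>2)"
      by (rule Cauchy_Schwarz_ineq_sum)
    also have "\<dots> \<le> ((1 + degree w * \<Delta> / vol) / degree w) * (2 * \<Delta> * D / \<phi>\<^sup>2)"
      using r_sq var by (intro mult_mono' sum_nonneg) auto
    also have "\<dots> = (D / degree w) * ((1 + degree w * \<Delta> / vol) * (2 * \<Delta>) / \<phi>\<^sup>2)"
      by (simp add: field_simps)
    finally have "(\<Sum>v\<in>V. r v * (h v - m)) \<le> sqrt ((D / degree w) * ((1 + degree w * \<Delta> / vol) * (2 * \<Delta>) / \<phi>\<^sup>2))"
      by (rule real_le_rsqrt)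
    also have "\<dots> = sqrt (D / degree w) * c"
      using assms(2) by (simp add: c_def real_sqrt_mult real_sqrt_divide)
    finally show ?thesis .
  qed
  have "D / vol = (\<Sum>u\<in>V. a w u * h u) / degree w + (\<Sum>v\<in>V. r v * (h v - m))"
  proof -
    have "(\<Sum>v\<in>V. r v) = 0"
      using vol_pos assms(5)
      by (simp add: r_def sum_subtractf sum_divide_distrib[symmetric] a_deg deg_vol)
    then have "(\<Sum>v\<in>V. r v * (h v - m)) = (\<Sum>v\<in>V. r v * h v)"
      by (simp add: right_diff_distrib sum_subtractf sum_distrib_right[symmetric])
    also have "\<dots> = D / vol - (\<Sum>u\<in>V. a w u * h u) / degree w"
      by (simp add: r_def left_diff_distrib sum_subtractf D_def sum_divide_distrib)
    finally show ?thesis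
      by simp
  qed
  with first second have le: "D / vol \<le> sqrt (D / degree w) * (1 + c)"
    by (simp add: distrib_left)
  \<comment> \<open>Squaring \<open>le\<close> and cancelling one factor \<open>D / vol\<close>
    makes the implicit bound explicit; \<open>D = 0\<close> is split off for the
    cancellation.\<close>
  have "D / vol \<le> vol / degree w * (1 + c)\<^sup>2"
  proof (cases "D = 0")
    case False
    then have D_pos: "0 < D"
      using D_nn by simp
    have "(D / vol)\<^sup>2 \<le> (sqrt (D / degree w) * (1 + c))\<^sup>2"
      using le vol_pos D_nn by (intro power_mono) auto
    also have "\<dots> = D / degree w * (1 + c)\<^sup>2"
      using D_nn assms(5) by (simp add: power_mult_distrib)
    finally have "D / vol * (D / vol) \<le> D / vol * (vol / degree w * (1 + c)\<^sup>2)"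
      using vol_pos by (simp add: power2_eq_square)
    moreover have "0 < D / vol"
      using D_pos vol_pos by simp
    ultimately show ?thesis
      by (simp only: mult_le_cancel_left_pos)
  next
    case True
    then show ?thesis
      using vol_pos assms(5) by simp
  qed
  then show ?thesis
    by (simp add: D_def c_def sum_divide_distrib)
qed

text \<open>The Laplacian of any function sums to zero over \<open>V\<close>, so prescribing it off
  \<open>w\<close> forces the star sum at \<open>w\<close> to be \<open>vol - degree w\<close>.
  Cauchy-Schwarz on the star then bounds the energy from below.\<close>

lemma solution_lower_bound:
  assumes "w \<in> V" "0 < degree w" "h w = 0"
    and "\<And>v. v \<in> V \<Longrightarrow> v \<noteq> w \<Longrightarrow> degree v * h v - (\<Sum>u\<in>V. a v u * h u) = degree v"
  shows "(vol - degree w)\<^sup>2 / (vol * degree w) \<le> (\<Sum>v\<in>V. degree v / vol * h v)"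
proof -
  define D where "D = (\<Sum>v\<in>V. degree v * h v)"
  have "degree w \<le> vol"
    unfolding vol_def using assms(1) finite_V degree_nonneg by (intro member_le_sum) auto
  then have vol_pos: "0 < vol"
    using assms(2) by simp
  have "(\<Sum>v\<in>V. h v * (degree v * h v - (\<Sum>u\<in>V. a v u * h u))) = D"
    unfolding D_def
  proof (intro sum.cong refl)
    fix v assume "v \<in> V"
    then show "h v * (degree v * h v - (\<Sum>u\<in>V. a v u * h u)) = degree v * h v"
      using assms(3) assms(4)[of v] by (cases "v = w") auto
  qed
  then have E: "energy h = 2 * D"
    by (simp add: energy_eq_laplacian)
  have zero: "(\<Sum>v\<in>V. degree v * h v - (\<Sum>u\<in>V. a v u * h u)) = 0"
    by (simp only: sum_subtractf sum_a_const' diff_self)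
  have "(\<Sum>v\<in>V. degree v * h v - (\<Sum>u\<in>V. a v u * h u))
      = - (\<Sum>u\<in>V. a w u * h u) + (\<Sum>v\<in>V - {w}. degree v)"
    using assms finite_V by (subst sum.remove[of V w]) auto
  moreover have "(\<Sum>v\<in>V - {w}. degree v) = vol - degree w"
    unfolding vol_def using assms(1) finite_V by (subst sum.remove[of V w]) auto
  ultimately have "(vol - degree w)\<^sup>2 = (\<Sum>u\<in>V. a w u * h u)\<^sup>2"
    using zero by simp
  also have "\<dots> \<le> degree w * (\<Sum>u\<in>V. a w u * (h u)\<^sup>2)"
    by (rule star_sum_sq_le)
  also have "\<dots> \<le> degree w * D"
    using energy_ge_star[of w h] assms E by simp
  finally have "(vol - degree w)\<^sup>2 / (vol * degree w) \<le> D / vol"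
    using vol_pos assms(2) by (simp add: field_simps)
  then show ?thesis
    by (simp add: D_def sum_divide_distrib)
qed

end

subsection \<open>Survival probabilities of the random walk\<close>

lemma sets_rw_measure:
  "sets (rw_measure V E v) = sets (PiM UNIV (\<lambda>_. count_space UNIV))"
proof -
  interpret Ionescu_Tulcea "rw_kernel V E v" "\<lambda>_. count_space UNIV"
    by (rule Ionescu_Tulcea_rw_kernel)
  show ?thesis
    unfolding rw_measure_def by (rule PF.sets_lim)
qed

lemma stay_sets: "{\<omega>. \<forall>i\<le>n. P (\<omega> i)} \<in> sets (rw_measure V E v)"
proof -
  have "{\<omega> \<in> space (PiM UNIV (\<lambda>_. count_space UNIV)). \<forall>i\<in>{..n}. P (\<omega> i)}
      \<in> sets (PiM UNIV (\<lambda>_. count_space (UNIV :: nat set)))"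
    by measurable
  then show ?thesis
    by (simp add: sets_rw_measure space_PiM Ball_def)
qed

fun path_prob :: "nat set \<Rightarrow> nat set set \<Rightarrow> nat \<Rightarrow> nat list \<Rightarrow> real" where
  "path_prob V E v [] = 1"
| "path_prob V E v (y # ys) = pmf (rw_step V E v) y * path_prob V E y ys"

lemma path_prob_nonneg: "0 \<le> path_prob V E v xs"
  by (induction xs arbitrary: v) auto

lemma path_prob_eq_prod:
  "path_prob V E v ys = (\<Prod>i<length ys. pmf (rw_step V E ((v # ys) ! i)) ((v # ys) ! Suc i))"
  by (induction ys arbitrary: v) (simp_all add: prod.lessThan_Suc_shift del: prod.lessThan_Suc)

text \<open>The start is not tested, only the next \<open>n\<close> positions. The recursion is thus
  a plain first-step decomposition, and the condition on \<open>v\<close> is left to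
  \<open>emeasure_stay\<close>.\<close>

primrec stay_prob :: "nat set \<Rightarrow> nat set set \<Rightarrow> nat set \<Rightarrow> nat \<Rightarrow> nat \<Rightarrow> real" where
  "stay_prob V E W 0 v = 1"
| "stay_prob V E W (Suc n) v = (\<Sum>y\<in>W. pmf (rw_step V E v) y * stay_prob V E W n y)"

lemma stay_prob_nonneg: "0 \<le> stay_prob V E W n v"
  by (induction n arbitrary: v) (auto intro!: sum_nonneg mult_nonneg_nonneg)

lemma sum_path_prob:
  assumes "finite W"
  shows "(\<Sum>ys | set ys \<subseteq> W \<and> length ys = n. path_prob V E v ys) = stay_prob V E W n v"
proof (induction n arbitrary: v)
  case 0
  have "{ys. set ys \<subseteq> W \<and> length ys = 0} = {[]}"
    by auto
  then show ?case
    by simp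
next
  case (Suc n)
  have inj: "inj_on (\<lambda>(ys, y). y # ys) ({ys. set ys \<subseteq> W \<and> length ys = n} \<times> W)"
    by (auto simp: inj_on_def)
  have "(\<Sum>ys | set ys \<subseteq> W \<and> length ys = Suc n. path_prob V E v ys)
      = (\<Sum>ys | set ys \<subseteq> W \<and> length ys = n. \<Sum>y\<in>W. path_prob V E v (y # ys))"
    unfolding lists_length_Suc_eq
    by (subst sum.reindex[OF inj]) (simp add: sum.cartesian_product split_def)
  also have "\<dots> = (\<Sum>y\<in>W. \<Sum>ys | set ys \<subseteq> W \<and> length ys = n. path_prob V E v (y # ys))"
    by (rule sum.swap)
  also have "\<dots> = stay_prob V E W (Suc n) v"
    by (simp add: sum_distrib_left[symmetric] Suc.IH)
  finally show ?case .
qed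

text \<open>Finitely many coordinates with values in a finite set: the event is a finite disjoint
  union of cylinders, whose masses are products of one-step probabilities.\<close>

lemma emeasure_stay:
  assumes "finite W"
  shows "emeasure (rw_measure V E v) {\<omega>. \<forall>i\<le>n. \<omega> i \<in> W}
    = (if v \<in> W then ennreal (stay_prob V E W n v) else 0)"
proof -
  let ?M = "rw_measure V E v"
  \<comment> \<open>A trajectory up to time \<open>n\<close> has \<open>Suc n\<close> positions; the
    head of the list is the position at time 0.\<close>
  define L where "L = {xs. set xs \<subseteq> W \<and> length xs = Suc n}"
  define C where "C xs = {\<omega>. \<forall>i\<le>n. \<omega> i = xs ! i}" for xs :: "nat list"
  have fL: "finite L"
    unfolding L_def by (rule finite_lists_length_eq[OF assms])
  have C_sets: "C xs \<in> sets ?M" for xs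
  proof -
    have "{\<omega> \<in> space (PiM UNIV (\<lambda>_. count_space UNIV)). \<forall>i\<in>{..n}. \<omega> i = xs ! i}
        \<in> sets (PiM UNIV (\<lambda>_. count_space (UNIV :: nat set)))"
      by measurable
    then show ?thesis
      by (simp add: C_def sets_rw_measure space_PiM Ball_def)
  qed
  have "{\<omega>. \<forall>i\<le>n. \<omega> i \<in> W} = (\<Union>xs\<in>L. C xs)"
  proof (intro equalityI subsetI)
    fix \<omega> assume "\<omega> \<in> {\<omega>. \<forall>i\<le>n. \<omega> i \<in> W}"
    then have "map \<omega> [0..<Suc n] \<in> L" "\<omega> \<in> C (map \<omega> [0..<Suc n])"
      by (auto simp: L_def C_def nth_append less_Suc_eq_le simp del: upt_Suc)
    then show "\<omega> \<in> (\<Union>xs\<in>L. C xs)"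
      by blast
  next
    fix \<omega> assume "\<omega> \<in> (\<Union>xs\<in>L. C xs)"
    then obtain xs where "xs \<in> L" "\<omega> \<in> C xs"
      by blast
    then show "\<omega> \<in> {\<omega>. \<forall>i\<le>n. \<omega> i \<in> W}"
      by (auto simp: L_def C_def subset_iff)
  qed
  moreover have "disjoint_family_on C L"
  proof (unfold disjoint_family_on_def, intro ballI impI)
    fix xs ys assume *: "xs \<in> L" "ys \<in> L" "xs \<noteq> ys"
    then obtain i where "i \<le> n" "xs ! i \<noteq> ys ! i"
      by (auto simp: L_def list_eq_iff_nth_eq less_Suc_eq_le)
    then show "C xs \<inter> C ys = {}"
      by (auto simp: C_def)
  qed
  ultimately have "emeasure ?M {\<omega>. \<forall>i\<le>n. \<omega> i \<in> W} = (\<Sum>xs\<in>L. emeasure ?M (C xs))"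
    using C_sets fL by (simp add: sum_emeasure image_subset_iff)
  also have "\<dots> = (\<Sum>ys | set ys \<subseteq> W \<and> length ys = n. \<Sum>y\<in>W. emeasure ?M (C (y # ys)))"
  proof -
    have inj: "inj_on (\<lambda>(ys, y). y # ys) ({ys. set ys \<subseteq> W \<and> length ys = n} \<times> W)"
      by (auto simp: inj_on_def)
    show ?thesis
      unfolding L_def lists_length_Suc_eq
      by (subst sum.reindex[OF inj]) (simp add: sum.cartesian_product split_def)
  qed
  also have "\<dots> = (\<Sum>ys | set ys \<subseteq> W \<and> length ys = n.
      if v \<in> W then ennreal (path_prob V E v ys) else 0)"
  proof (intro sum.cong refl)
    fix ys assume "ys \<in> {ys. set ys \<subseteq> W \<and> length ys = n}"
    then have "emeasure ?M (C (y # ys)) = (if y = v then ennreal (path_prob V E v ys) else 0)" for y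
      using rw_measure_cylinder[of V E v n "\<lambda>i. (y # ys) ! i"]
      by (auto simp: C_def path_prob_eq_prod)
    then show "(\<Sum>y\<in>W. emeasure ?M (C (y # ys)))
        = (if v \<in> W then ennreal (path_prob V E v ys) else 0)"
      using assms by simp
  qed
  also have "\<dots> = (if v \<in> W then ennreal (stay_prob V E W n v) else 0)"
    by (simp add: sum_path_prob[OF assms, symmetric] sum_ennreal path_prob_nonneg)
  finally show ?thesis .
qed

section \<open>Survival probabilities and the tail-sum formula\<close>

lemma set_rw_step_subset: "v \<in> V \<Longrightarrow> finite V \<Longrightarrow> set_pmf (rw_step V E v) \<subseteq> V"
  by (auto simp: rw_step_def nbrs_def)

lemma stay_prob_whole:
  assumes "finite V" "v \<in> V"
  shows "stay_prob V E V n v = 1"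
  using assms(2)
proof (induction n arbitrary: v)
  case (Suc n)
  have "(\<Sum>y\<in>V. pmf (rw_step V E v) y * stay_prob V E V n y) = (\<Sum>y\<in>V. pmf (rw_step V E v) y)"
    by (intro sum.cong refl) (simp add: Suc.IH)
  also have "\<dots> = 1"
    using assms(1) set_rw_step_subset[OF Suc.prems assms(1)] by (rule sum_pmf_eq_1)
  finally show ?case
    by simp
qed simp

text \<open>Almost surely the walk stays in \<open>V\<close>, so avoiding \<open>w\<close> amounts
  to staying in the finite set \<open>V - {w}\<close>, to which \<open>emeasure_stay\<close>
  applies.\<close>

lemma emeasure_not_hit:
  assumes "finite V" "v \<in> V"
  shows "emeasure (rw_measure V E v) {\<omega>. \<forall>i\<le>n. \<omega> i \<noteq> w}
    = (if v = w then 0 else ennreal (stay_prob V E (V - {w}) n v))"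
proof -
  let ?M = "rw_measure V E v"
  interpret prob_space ?M
    by (rule prob_space_rw_measure)
  have "emeasure ?M {\<omega>. \<forall>i\<le>n. \<omega> i \<in> V} = 1"
    using assms by (simp add: emeasure_stay stay_prob_whole)
  then have "prob {\<omega>. \<forall>i\<le>n. \<omega> i \<in> V} = 1"
    by (simp add: measure_def)
  then have "AE \<omega> in ?M. \<omega> \<in> {\<omega>. \<forall>i\<le>n. \<omega> i \<in> V}"
    by (rule AE_prob_1)
  then have "emeasure ?M {\<omega>. \<forall>i\<le>n. \<omega> i \<noteq> w} = emeasure ?M {\<omega>. \<forall>i\<le>n. \<omega> i \<in> V - {w}}"
    by (intro emeasure_eq_AE stay_sets) auto
  also have "\<dots> = (if v = w then 0 else ennreal (stay_prob V E (V - {w}) n v))"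
    using assms by (subst emeasure_stay) auto
  finally show ?thesis .
qed

text \<open>Tail-sum formula path by path: the indicator of index \<open>n\<close> is 1 exactly when
  \<open>n\<close> precedes the first visit. Without a visit both sides are infinite, the left one
  as an infimum over the empty set.\<close>

lemma hit_time_eq_suminf: "hit_time w \<omega> = (\<Sum>n. indicator {\<omega>. \<forall>i\<le>n. \<omega> i \<noteq> w} \<omega>)"
proof (cases "\<exists>n. \<omega> n = w")
  case True
  define T where "T = (LEAST n. \<omega> n = w)"
  have T: "\<omega> T = w" and least: "\<And>n. \<omega> n = w \<Longrightarrow> T \<le> n"
    using True unfolding T_def by (auto intro: LeastI_ex Least_le)
  have "hit_time w \<omega> = of_nat T"
    unfolding hit_time_def
  proof (rule antisym)
    show "(INF n\<in>{n. \<omega> n = w}. of_nat n) \<le> (of_nat T :: ennreal)"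
      by (rule INF_lower) (simp add: T)
    show "(of_nat T :: ennreal) \<le> (INF n\<in>{n. \<omega> n = w}. of_nat n)"
      by (rule INF_greatest) (simp add: least)
  qed
  moreover have "(\<Sum>n. indicator {\<omega>. \<forall>i\<le>n. \<omega> i \<noteq> w} \<omega>) = (\<Sum>n<T. 1 :: ennreal)"
  proof -
    have iff: "(\<forall>i\<le>n. \<omega> i \<noteq> w) \<longleftrightarrow> n < T" for n
    proof
      show "n < T" if "\<forall>i\<le>n. \<omega> i \<noteq> w"
        using that T by (force simp: not_le[symmetric])
      show "\<forall>i\<le>n. \<omega> i \<noteq> w" if "n < T"
        using that least by force
    qed
    have "(\<Sum>n. indicator {\<omega>. \<forall>i\<le>n. \<omega> i \<noteq> w} \<omega>)
        = (\<Sum>n<T. indicator {\<omega>. \<forall>i\<le>n. \<omega> i \<noteq> w} \<omega> :: ennreal)"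
      by (intro suminf_finite) (auto simp: iff indicator_def)
    then show ?thesis
      by (simp add: iff indicator_def)
  qed
  ultimately show ?thesis
    by simp
next
  case False
  then have "hit_time w \<omega> = \<top>"
    by (simp add: hit_time_def)
  moreover have "(\<Sum>n. indicator {\<omega>. \<forall>i\<le>n. \<omega> i \<noteq> w} \<omega>) = (\<Sum>n::nat. 1 :: ennreal)"
    using False by simp
  moreover have "(\<Sum>n::nat. 1 :: ennreal) = \<top>"
  proof -
    have "of_nat n \<le> (\<Sum>n::nat. 1 :: ennreal)" for n
      using sum_le_suminf[of "\<lambda>_. 1 :: ennreal" "{..<n}"] by simp
    then show ?thesis
      using SUP_least[of UNIV of_nat "\<Sum>n::nat. 1 :: ennreal"]
      by (simp add: ennreal_SUP_of_nat_eq_top top_unique)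
  qed
  ultimately show ?thesis
    by simp
qed

lemma exp_hit_eq_suminf:
  assumes "finite V" "v \<in> V"
  shows "exp_hit V E v w = (\<Sum>n. if v = w then 0 else ennreal (stay_prob V E (V - {w}) n v))"
proof -
  have "exp_hit V E v w = (\<Sum>n. emeasure (rw_measure V E v) {\<omega>. \<forall>i\<le>n. \<omega> i \<noteq> w})"
    unfolding exp_hit_def hit_time_eq_suminf using stay_sets[of _ "\<lambda>x. x \<noteq> w"]
    by (subst nn_integral_suminf) auto
  then show ?thesis
    by (simp add: emeasure_not_hit[OF assms])
qed

section \<open>The graph of the walk as a weighted graph\<close>

definition adjacency :: "nat set set \<Rightarrow> nat \<Rightarrow> nat \<Rightarrow> real" where
  "adjacency E u v = of_bool ({u, v} \<in> E)"

lemma weighted_graph_adjacency: "finite V \<Longrightarrow> weighted_graph V (adjacency E)"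
  by unfold_locales (auto simp: adjacency_def insert_commute)

lemma sum_adjacency:
  assumes "finite V"
  shows "(\<Sum>u\<in>V. adjacency E v u) = real (deg V E v)"
  using assms by (simp add: adjacency_def nbrs_def Int_def)

text \<open>Double counting of the ordered pairs lying over \<open>E\<close>: an edge between
  distinct vertices has two preimages, a loop has one. This identifies the denominator of
  \<open>inv_dist\<close> with the volume.\<close>

lemma sum_deg:
  assumes "finite V" "E \<subseteq> {{v, w} | v w. v \<in> V \<and> w \<in> V}"
  shows "(\<Sum>v\<in>V. real (deg V E v)) = 2 * real (card E) - real (card (loops E))"
proof -
  define P where "P = Sigma V (nbrs V E)"
  have "E \<subseteq> Pow V"
    using assms(2) by auto
  then have fE: "finite E"
    using assms(1) by (meson finite_Pow_iff finite_subset)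
  have fP: "finite P"
    using assms(1) by (auto simp: P_def nbrs_def)
  have fibre: "real (card {x\<in>P. {fst x, snd x} = e}) = 2 - of_bool (card e = 1)" if "e \<in> E" for e
  proof -
    have "e \<in> {{v, w} | v w. v \<in> V \<and> w \<in> V}"
      using assms(2) that by (rule subsetD)
    then obtain v w where vw: "e = {v, w}" "v \<in> V" "w \<in> V"
      by auto
    have "{x\<in>P. {fst x, snd x} = e} = {(v, w), (w, v)}"
      using that vw by (auto simp: P_def nbrs_def doubleton_eq_iff insert_commute)
    then show ?thesis
      using vw by (cases "v = w") auto
  qed
  have "(\<Sum>v\<in>V. real (deg V E v)) = real (card P)"
    unfolding P_def using assms(1) by (subst card_SigmaI) (auto simp: nbrs_def)
  also have "card P = (\<Sum>e\<in>E. card {x\<in>P. {fst x, snd x} = e})"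
  proof -
    have "(\<Sum>e\<in>E. \<Sum>x\<in>{x\<in>P. {fst x, snd x} = e}. 1::nat) = (\<Sum>x\<in>P. 1)"
      using fP fE by (intro sum.group) (auto simp: P_def nbrs_def)
    then show ?thesis
      by simp
  qed
  also have "real \<dots> = (\<Sum>e\<in>E. 2 - of_bool (card e = 1))"
    by (simp add: fibre)
  also have "\<dots> = 2 * real (card E) - real (card (loops E))"
    using fE by (simp add: sum_subtractf loops_def Int_def)
  finally show ?thesis .
qed

lemma pmf_rw_step:
  assumes "finite V" "0 < deg V E v" "u \<in> V"
  shows "pmf (rw_step V E v) u = adjacency E v u / real (deg V E v)"
proof -
  have "nbrs V E v \<noteq> {}" "finite (nbrs V E v)"
    using assms by (auto simp: nbrs_def card_gt_0_iff)
  then show ?thesis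
    using assms(3) by (simp add: rw_step_def pmf_of_set) (simp add: adjacency_def nbrs_def indicator_def)
qed

text \<open>Vanishing at \<open>w\<close> lets the first-step recursion run over all of
  \<open>V\<close>, so that it becomes a statement about the graph Laplacian.\<close>

definition avoid_prob :: "nat set \<Rightarrow> nat set set \<Rightarrow> nat \<Rightarrow> nat \<Rightarrow> nat \<Rightarrow> real" where
  "avoid_prob V E w n v = (if v = w then 0 else stay_prob V E (V - {w}) n v)"

lemma avoid_prob_0: "avoid_prob V E w 0 v = of_bool (v \<noteq> w)"
  by (simp add: avoid_prob_def)

lemma avoid_prob_Suc:
  assumes "finite V" "0 < deg V E v" "v \<noteq> w"
  shows "real (deg V E v) * avoid_prob V E w (Suc n) v
    = (\<Sum>u\<in>V. adjacency E v u * avoid_prob V E w n u)"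
proof -
  have "avoid_prob V E w (Suc n) v
      = (\<Sum>u\<in>V - {w}. adjacency E v u / real (deg V E v) * avoid_prob V E w n u)"
    using assms by (simp add: avoid_prob_def pmf_rw_step)
  also have "\<dots> = (\<Sum>u\<in>V. adjacency E v u / real (deg V E v) * avoid_prob V E w n u)"
    using assms(1) by (intro sum.mono_neutral_left) (auto simp: avoid_prob_def)
  finally show ?thesis
    using assms(2) by (simp add: sum_distrib_left)
qed

lemma exp_hit_eq_avoid_prob:
  assumes "finite V" "v \<in> V"
  shows "exp_hit V E v w = (\<Sum>n. ennreal (avoid_prob V E w n v))"
  unfolding exp_hit_eq_suminf[OF assms] avoid_prob_def by (intro suminf_cong) simp

text \<open>The upper bound comes first, for partial sums of the survival series, where no
  finiteness is at stake. Its uniformity gives summability, after which the full series solves the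
  Laplace equation exactly and the lower bound applies.\<close>

lemma stat_hit_bounds:
  fixes vol \<Delta> \<phi> :: real
  assumes fV: "finite V" and E: "E \<subseteq> {{v, u} | v u. v \<in> V \<and> u \<in> V}" and w: "w \<in> V"
    and deg_pos: "\<And>v. v \<in> V \<Longrightarrow> 0 < deg V E v"
    and deg_le: "\<And>v. v \<in> V \<Longrightarrow> real (deg V E v) \<le> \<Delta>"
    and \<phi>: "0 < \<phi>" "weighted_graph.expansion V (adjacency E) \<phi>"
    and vol: "vol = (\<Sum>v\<in>V. real (deg V E v))"
  shows "stat_hit V E w \<le> ennreal (vol / deg V E w * (1 + sqrt ((1 + deg V E w * \<Delta> / vol) * (2 * \<Delta>)) / \<phi>)\<^sup>2)"
    and "ennreal ((vol - deg V E w)\<^sup>2 / (vol * deg V E w)) \<le> stat_hit V E w"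
proof -
  interpret G: weighted_graph V "adjacency E"
    by (rule weighted_graph_adjacency[OF fV])
  have degree: "G.degree v = real (deg V E v)" for v
    by (simp add: G.degree_def sum_adjacency[OF fV])
  have vol_eq: "G.vol = vol"
    by (simp add: G.vol_def degree vol)
  have \<pi>: "inv_dist V E v = G.degree v / G.vol" for v
    by (simp add: inv_dist_def degree vol_eq vol sum_deg[OF fV E])
  have \<pi>_pos: "0 < inv_dist V E v" if "v \<in> V" for v
  proof -
    have "0 < (\<Sum>v\<in>V. real (deg V E v))"
      using deg_pos w fV by (intro sum_pos) auto
    then have "0 < vol"
      by (simp only: vol)
    then show ?thesis
      using deg_pos[OF that] by (simp add: \<pi> degree vol_eq)
  qed
  define surv where "surv n v = avoid_prob V E w n v" for n v
  define s where "s n = (\<Sum>v\<in>V. inv_dist V E v * surv n v)" for n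
  define U where "U = vol / deg V E w * (1 + sqrt ((1 + deg V E w * \<Delta> / vol) * (2 * \<Delta>)) / \<phi>)\<^sup>2"
  have surv_nn: "0 \<le> surv n v" and surv_w: "surv n w = 0" for n v
    by (simp_all add: surv_def avoid_prob_def stay_prob_nonneg)
  have surv_0: "surv 0 v = 1" if "v \<noteq> w" for v
    using that by (simp add: surv_def avoid_prob_0)
  have term_nn: "0 \<le> inv_dist V E v * surv n v" if "v \<in> V" for n v
    using \<pi>_pos[OF that] surv_nn[of n v] by simp
  then have s_nn: "0 \<le> s n" for n
    unfolding s_def by (intro sum_nonneg) auto
  have surv_Suc: "G.degree v * surv (Suc n) v = (\<Sum>u\<in>V. adjacency E v u * surv n u)"
    if "v \<in> V" "v \<noteq> w" for n v
    unfolding surv_def degree using fV deg_pos that by (intro avoid_prob_Suc) auto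
  have stat_hit: "stat_hit V E w = (\<Sum>n. ennreal (s n))"
  proof -
    have "stat_hit V E w = (\<Sum>v\<in>V. \<Sum>n. ennreal (inv_dist V E v) * ennreal (surv n v))"
      unfolding stat_hit_def surv_def
      by (intro sum.cong refl) (simp add: exp_hit_eq_avoid_prob fV)
    also have "\<dots> = (\<Sum>n. \<Sum>v\<in>V. ennreal (inv_dist V E v) * ennreal (surv n v))"
      by (rule suminf_sum[symmetric]) simp
    also have "\<dots> = (\<Sum>n. ennreal (s n))"
    proof (intro suminf_cong)
      fix n
      have "(\<Sum>v\<in>V. ennreal (inv_dist V E v) * ennreal (surv n v))
          = (\<Sum>v\<in>V. ennreal (inv_dist V E v * surv n v))"
        using \<pi>_pos surv_nn by (intro sum.cong refl) (simp add: ennreal_mult less_imp_le)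
      then show "(\<Sum>v\<in>V. ennreal (inv_dist V E v) * ennreal (surv n v)) = ennreal (s n)"
        unfolding s_def using term_nn by (simp add: sum_ennreal)
    qed
    finally show ?thesis .
  qed
  have partial: "(\<Sum>n<K. s n) \<le> U" for K
  proof -
    define h where "h v = (\<Sum>n<K. surv n v)" for v
    have "(\<Sum>n<K. s n) = (\<Sum>v\<in>V. G.degree v / G.vol * h v)"
      unfolding s_def h_def \<pi>[symmetric] sum_distrib_left by (rule sum.swap)
    also have "\<dots> \<le> G.vol / G.degree w
        * (1 + sqrt ((1 + G.degree w * \<Delta> / G.vol) * (2 * \<Delta>)) / \<phi>)\<^sup>2"
    proof (rule G.supersolution_upper_bound)
      fix v assume v: "v \<in> V" "v \<noteq> w"
      \<comment> \<open>One more nonnegative term is added so that, after splitting off time 0, the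
        shifted sum again has exactly \<open>K\<close> terms.\<close>
      have "G.degree v * h v \<le> G.degree v * (\<Sum>n<Suc K. surv n v)"
        using surv_nn by (intro mult_left_mono G.degree_nonneg) (simp add: h_def)
      also have "\<dots> = G.degree v * surv 0 v + (\<Sum>n<K. G.degree v * surv (Suc n) v)"
        by (simp only: sum.lessThan_Suc_shift distrib_left sum_distrib_left)
      also have "\<dots> = G.degree v + (\<Sum>n<K. \<Sum>u\<in>V. adjacency E v u * surv n u)"
        using v by (simp add: surv_Suc surv_0)
      also have "(\<Sum>n<K. \<Sum>u\<in>V. adjacency E v u * surv n u) = (\<Sum>u\<in>V. adjacency E v u * h u)"
        unfolding h_def sum_distrib_left by (rule sum.swap)
      finally show "G.degree v * h v - (\<Sum>u\<in>V. adjacency E v u * h u) \<le> G.degree v"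
        by simp
    qed (use \<phi> deg_le deg_pos w surv_nn surv_w in
        \<open>auto simp: degree h_def adjacency_def intro!: sum_nonneg\<close>)
    finally show ?thesis
      by (simp add: U_def degree vol_eq)
  qed
  have summ_s: "summable s"
    using s_nn partial by (rule summableI_nonneg_bounded)
  have stat_hit': "stat_hit V E w = ennreal (suminf s)"
    unfolding stat_hit using s_nn summ_s by (rule suminf_ennreal2)
  have "suminf s \<le> U"
    using summ_s partial by (rule suminf_le_const)
  then show "stat_hit V E w \<le> ennreal U"
    unfolding stat_hit' by (rule ennreal_leI)
  \<comment> \<open>All stationary weights are positive, so summability of the average passes to
    each starting point.\<close>
  have summ: "summable (\<lambda>n. surv n v)" if "v \<in> V" for v
  proof (rule summable_comparison_test')
    show "summable (\<lambda>n. s n / inv_dist V E v)"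
      using summ_s by (rule summable_divide)
    show "norm (surv n v) \<le> s n / inv_dist V E v" for n
    proof -
      have "inv_dist V E v * surv n v \<le> s n"
        unfolding s_def using that fV term_nn by (intro member_le_sum) auto
      then show ?thesis
        using \<pi>_pos[OF that] surv_nn[of n v] by (simp add: field_simps)
    qed
  qed
  define h where "h v = (\<Sum>n. surv n v)" for v
  have "suminf s = (\<Sum>v\<in>V. \<Sum>n. inv_dist V E v * surv n v)"
    unfolding s_def using summ by (intro suminf_sum summable_mult)
  also have "\<dots> = (\<Sum>v\<in>V. G.degree v / G.vol * h v)"
    unfolding \<pi> h_def using summ by (intro sum.cong refl suminf_mult)
  finally have suminf_s: "suminf s = (\<Sum>v\<in>V. G.degree v / G.vol * h v)" .
  have "(G.vol - G.degree w)\<^sup>2 / (G.vol * G.degree w) \<le> (\<Sum>v\<in>V. G.degree v / G.vol * h v)"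
  proof (rule G.solution_lower_bound)
    show "h w = 0"
      by (simp add: h_def surv_w)
    fix v assume v: "v \<in> V" "v \<noteq> w"
    have "h v = surv 0 v + (\<Sum>n. surv (Suc n) v)"
      unfolding h_def using suminf_split_head[OF summ[OF v(1)]] by simp
    moreover have "summable (\<lambda>n. surv (Suc n) v)"
      using summ[OF v(1)] summable_Suc_iff[of "\<lambda>n. surv n v"] by simp
    ultimately have "G.degree v * h v = G.degree v + (\<Sum>n. G.degree v * surv (Suc n) v)"
      using v by (simp add: distrib_left suminf_mult surv_0)
    also have "(\<Sum>n. G.degree v * surv (Suc n) v) = (\<Sum>n. \<Sum>u\<in>V. adjacency E v u * surv n u)"
      using v by (simp add: surv_Suc)
    also have "\<dots> = (\<Sum>u\<in>V. \<Sum>n. adjacency E v u * surv n u)"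
      using summ by (intro suminf_sum summable_mult)
    also have "\<dots> = (\<Sum>u\<in>V. adjacency E v u * h u)"
      using summ by (intro sum.cong refl) (simp add: h_def suminf_mult)
    finally show "G.degree v * h v - (\<Sum>u\<in>V. adjacency E v u * h u) = G.degree v"
      by simp
  qed (use w deg_pos in \<open>auto simp: degree\<close>)
  then show "ennreal ((vol - deg V E w)\<^sup>2 / (vol * deg V E w)) \<le> stat_hit V E w"
    unfolding stat_hit' suminf_s by (intro ennreal_leI) (simp add: degree vol_eq)
qed

subsection \<open>Concentration in the stochastic block model\<close>

lemma exp_le_quadratic:
  fixes t :: real
  assumes "\<bar>t\<bar> \<le> 1"
  shows "exp t \<le> 1 + t + t\<^sup>2"
proof (cases "0 \<le> t")
  case True
  then show ?thesis
    using assms exp_bound[of t] by simp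
next
  case False
  \<comment> \<open>For negative \<open>t\<close> the reciprocal is estimated: the product is 1 -
    t^3, hence at least 1, and \<open>1 - t\<close> is at most \<open>exp (- t)\<close>.\<close>
  have "1 \<le> (1 + t + t\<^sup>2) * (1 - t)"
  proof -
    have "(1 + t + t\<^sup>2) * (1 - t) = 1 + (- t) ^ 3"
      by (simp add: power2_eq_square power3_eq_cube algebra_simps)
    then show ?thesis
      using False by simp
  qed
  also have "\<dots> \<le> (1 + t + t\<^sup>2) * exp (- t)"
    using exp_ge_add_one_self[of "- t"] assms False by (intro mult_left_mono) auto
  finally show ?thesis
    by (simp add: exp_minus field_simps)
qed

definition random_subset :: "'a set \<Rightarrow> ('a \<Rightarrow> real) \<Rightarrow> 'a set pmf" where
  "random_subset A pr = map_pmf (\<lambda>a. {e \<in> A. a e}) (Pi_pmf A False (\<lambda>e. bernoulli_pmf (pr e)))"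

lemma set_random_subset: "finite A \<Longrightarrow> set_pmf (random_subset A pr) \<subseteq> Pow A"
  by (auto simp: random_subset_def)

text \<open>By independence the expectation is a product over \<open>J\<close> of factors
  \<open>1 + pr e * (exp t - 1)\<close>, each at most the exponential of
  \<open>pr e * (exp t - 1)\<close>.\<close>

lemma random_subset_mgf:
  assumes "finite A" "J \<subseteq> A" "\<And>e. e \<in> A \<Longrightarrow> pr e \<in> {0..1}"
  shows "measure_pmf.expectation (random_subset A pr) (\<lambda>E. exp (t * real (card (E \<inter> J))))
    \<le> exp ((exp t - 1) * (\<Sum>e\<in>J. pr e))"
proof -
  let ?P = "Pi_pmf A False (\<lambda>e. bernoulli_pmf (pr e))"
  let ?f = "\<lambda>e b. if e \<in> J \<and> b then exp t else 1"
  have fJ: "finite J"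
    using assms(1,2) finite_subset by blast
  have AJ: "A \<inter> J = J"
    using assms(2) by blast
  have "exp (t * real (card ({e \<in> A. a e} \<inter> J))) = (\<Prod>e\<in>A. ?f e (a e))" for a
  proof -
    have "{e \<in> A. a e} \<inter> J = A \<inter> {e. e \<in> J \<and> a e}"
      by auto
    then show ?thesis
      using assms(1) by (simp add: prod.If_cases exp_of_nat2_mult)
  qed
  then have "measure_pmf.expectation (random_subset A pr) (\<lambda>E. exp (t * real (card (E \<inter> J))))
      = measure_pmf.expectation ?P (\<lambda>a. \<Prod>e\<in>A. ?f e (a e))"
    by (simp add: random_subset_def)
  also have "\<dots> = (\<Prod>e\<in>A. measure_pmf.expectation (bernoulli_pmf (pr e)) (?f e))"
    using assms(1) by (intro expectation_prod_Pi_pmf) (auto intro: integrable_measure_pmf_finite)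
  also have "\<dots> = (\<Prod>e\<in>A. if e \<in> J then 1 + pr e * (exp t - 1) else 1)"
    using assms(3) by (intro prod.cong refl) (simp add: algebra_simps)
  also have "\<dots> = (\<Prod>e\<in>J. 1 + pr e * (exp t - 1))"
    using assms(1) by (simp add: prod.If_cases AJ)
  also have "\<dots> \<le> (\<Prod>e\<in>J. exp (pr e * (exp t - 1)))"
  proof (intro prod_mono conjI)
    fix e assume "e \<in> J"
    then have pr: "pr e \<in> {0..1}"
      using assms(2,3) by blast
    then have "0 \<le> (1 - pr e) + pr e * exp t"
      by simp
    then show "0 \<le> 1 + pr e * (exp t - 1)"
      by (simp add: algebra_simps)
    show "1 + pr e * (exp t - 1) \<le> exp (pr e * (exp t - 1))"
      by (rule exp_ge_add_one_self)
  qed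
  also have "\<dots> = exp ((exp t - 1) * (\<Sum>e\<in>J. pr e))"
    using fJ by (simp add: exp_sum[symmetric] sum_distrib_right[symmetric] mult.commute)
  finally show ?thesis .
qed

text \<open>Markov's inequality for the exponential moment; the exponent is
  \<open>t + t\<^sup>2 - t * (1 + 2 * t)\<close>, which equals \<open>- t\<^sup>2\<close>. The
  factor \<open>t\<close> on both sides of the event covers both tails at once, since a negative
  \<open>t\<close> reverses the inequality.\<close>

lemma random_subset_tail:
  assumes "finite A" "J \<subseteq> A" "\<And>e. e \<in> A \<Longrightarrow> pr e \<in> {0..1}" "\<bar>t\<bar> \<le> 1"
  shows "measure_pmf.prob (random_subset A pr)
      {E. t * (1 + 2 * t) * (\<Sum>e\<in>J. pr e) \<le> t * real (card (E \<inter> J))}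
    \<le> exp (- (t\<^sup>2 * (\<Sum>e\<in>J. pr e)))"
proof -
  define m where "m = (\<Sum>e\<in>J. pr e)"
  let ?R = "random_subset A pr"
  have m_nn: "0 \<le> m"
    unfolding m_def using assms(2,3) by (intro sum_nonneg) fastforce
  have "finite (set_pmf ?R)"
    using set_random_subset[OF assms(1)] assms(1) by (meson finite_Pow_iff finite_subset)
  then have "integrable ?R (\<lambda>E. exp (t * real (card (E \<inter> J))))"
    by (rule integrable_measure_pmf_finite)
  then have "measure_pmf.prob ?R {E\<in>space ?R. exp (t * (1 + 2 * t) * m) \<le> exp (t * real (card (E \<inter> J)))}
      \<le> measure_pmf.expectation ?R (\<lambda>E. exp (t * real (card (E \<inter> J)))) / exp (t * (1 + 2 * t) * m)"
    by (intro integral_Markov_inequality_measure[where A = UNIV]) auto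
  also have "\<dots> \<le> exp ((exp t - 1) * m) / exp (t * (1 + 2 * t) * m)"
    unfolding m_def using assms(1-3) by (intro divide_right_mono random_subset_mgf) auto
  also have "\<dots> \<le> exp ((t + t\<^sup>2) * m) / exp (t * (1 + 2 * t) * m)"
    using exp_le_quadratic[OF assms(4)] m_nn by (intro divide_right_mono) (auto intro!: mult_right_mono)
  also have "\<dots> = exp (- (t\<^sup>2 * m))"
    by (simp add: exp_diff[symmetric] power2_eq_square algebra_simps)
  finally show ?thesis
    by (simp add: m_def)
qed

lemma random_subset_lower_tail:
  assumes "finite A" "J \<subseteq> A" "\<And>e. e \<in> A \<Longrightarrow> pr e \<in> {0..1}" "0 < t" "t \<le> 1"
  shows "measure_pmf.prob (random_subset A pr)
      {E. real (card (E \<inter> J)) \<le> (1 - 2 * t) * (\<Sum>e\<in>J. pr e)}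
    \<le> exp (- (t\<^sup>2 * (\<Sum>e\<in>J. pr e)))"
  using random_subset_tail[OF assms(1-3), where t = "- t"] assms(4,5) by (simp add: mult.assoc)

lemma random_subset_upper_tail:
  assumes "finite A" "J \<subseteq> A" "\<And>e. e \<in> A \<Longrightarrow> pr e \<in> {0..1}" "0 < t" "t \<le> 1"
  shows "measure_pmf.prob (random_subset A pr)
      {E. (1 + 2 * t) * (\<Sum>e\<in>J. pr e) \<le> real (card (E \<inter> J))}
    \<le> exp (- (t\<^sup>2 * (\<Sum>e\<in>J. pr e)))"
  using random_subset_tail[OF assms(1-3), where t = t] assms(4,5) by (simp add: mult.assoc)

section \<open>Expected degrees and expected cuts\<close>

lemma finite_edge_slots: "finite (edge_slots N)"
proof (rule finite_subset)
  show "edge_slots N \<subseteq> Pow {1..N}"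
    by (auto simp: edge_slots_def)
qed simp

lemma sbm_eq_random_subset: "sbm N B p q = random_subset (edge_slots N) (edge_prob B p q)"
  by (simp add: sbm_def random_subset_def)

lemma edge_prob_in: "p \<in> {0..1} \<Longrightarrow> q \<in> {0..1} \<Longrightarrow> edge_prob B p q e \<in> {0..1}"
  by (simp add: edge_prob_def)

text \<open>Degrees, and likewise cuts below, are expressed as the number of chosen slots in a fixed
  slot set, the form to which the tail bounds apply.\<close>

lemma deg_eq_card_Int: "real (deg V E v) = real (card (E \<inter> (\<lambda>u. {v, u}) ` V))"
proof -
  have "E \<inter> (\<lambda>u. {v, u}) ` V = (\<lambda>u. {v, u}) ` nbrs V E v"
    by (auto simp: nbrs_def)
  moreover have "inj_on (\<lambda>u. {v, u}) (nbrs V E v)"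
    by (auto simp: inj_on_def doubleton_eq_iff)
  ultimately show ?thesis
    by (simp add: card_image)
qed

lemma inj_on_doubleton: "S \<inter> T = {} \<Longrightarrow> inj_on (\<lambda>(u, v). {u, v}) (S \<times> T)"
  by (auto simp: inj_on_def doubleton_eq_iff)

lemma cut_eq_card_Int:
  assumes "finite V" "S \<subseteq> V"
  shows "weighted_graph.cut V (adjacency E) S = real (card (E \<inter> (\<lambda>(u, v). {u, v}) ` (S \<times> (V - S))))"
proof -
  interpret G: weighted_graph V "adjacency E"
    by (rule weighted_graph_adjacency[OF assms(1)])
  let ?g = "\<lambda>(u, v). {u, v}"
  let ?D = "{x \<in> S \<times> (V - S). ?g x \<in> E}"
  have fS: "finite (S \<times> (V - S))"
    using assms finite_subset by blast
  have "E \<inter> ?g ` (S \<times> (V - S)) = ?g ` ?D"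
    by auto
  moreover have "inj_on ?g ?D"
    by (rule inj_on_subset[OF inj_on_doubleton[of S "V - S"]]) auto
  ultimately have "real (card (E \<inter> ?g ` (S \<times> (V - S)))) = real (card ?D)"
    by (simp add: card_image)
  also have "\<dots> = (\<Sum>x\<in>S \<times> (V - S). of_bool (?g x \<in> E))"
    using fS by (simp add: Int_def)
  also have "\<dots> = G.cut S"
    unfolding G.cut_def adjacency_def by (simp add: sum.cartesian_product split_def)
  finally show ?thesis ..
qed

lemma real_card_Diff:
  assumes "finite A" "B \<subseteq> A"
  shows "real (card (A - B)) = real (card A) - real (card B)"
  using assms card_mono[OF assms] by (simp add: card_Diff_subset finite_subset of_nat_diff)

lemma edge_slotsI: "v \<in> {1..N} \<Longrightarrow> w \<in> {1..N} \<Longrightarrow> {v, w} \<in> edge_slots N"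
  unfolding edge_slots_def by blast

lemma equal_blocks_block:
  assumes "equal_blocks M N B" "v \<in> {1..N}"
  obtains b where "b \<in> B" "v \<in> b"
  using assms unfolding equal_blocks_def partition_on_def by blast

lemma equal_blocks_card:
  assumes "equal_blocks M N B" "b \<in> B" "0 < M"
  shows "real (card b) = real N / real M"
proof -
  have "real M * real (card b) = real N"
    using assms unfolding equal_blocks_def by (metis of_nat_mult)
  then show ?thesis
    using assms(3) by (simp add: field_simps)
qed

lemma equal_blocks_subset: "equal_blocks M N B \<Longrightarrow> b \<in> B \<Longrightarrow> b \<subseteq> {1..N}"
  unfolding equal_blocks_def partition_on_def by blast

lemma equal_blocks_eq:
  "equal_blocks M N B \<Longrightarrow> b \<in> B \<Longrightarrow> c \<in> B \<Longrightarrow> v \<in> b \<Longrightarrow> v \<in> c \<Longrightarrow> b = c"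
  unfolding equal_blocks_def partition_on_def disjoint_def by blast

lemma edge_prob_in_block:
  assumes "equal_blocks M N B" "b \<in> B" "v \<in> b"
  shows "edge_prob B p q {v, u} = (if u \<in> b then p else q)"
proof -
  have "(\<exists>c\<in>B. {v, u} \<subseteq> c) \<longleftrightarrow> u \<in> b"
  proof
    assume "\<exists>c\<in>B. {v, u} \<subseteq> c"
    then obtain c where c: "c \<in> B" "v \<in> c" "u \<in> c"
      by auto
    then show "u \<in> b"
      using equal_blocks_eq[OF assms(1,2) c(1) assms(3) c(2)] by simp
  qed (use assms(2,3) in auto)
  then show ?thesis
    by (simp add: edge_prob_def)
qed

text \<open>The loop slot at \<open>v\<close> belongs to the block of \<open>v\<close>, so exactly N
  / M slots have probability \<open>p\<close>.\<close>

lemma sum_edge_prob_star: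
  assumes "equal_blocks M N B" "0 < M" "v \<in> {1..N}"
  shows "(\<Sum>u\<in>{1..N}. edge_prob B p q {v, u}) = real N / real M * (p + (real M - 1) * q)"
proof -
  obtain b where b: "b \<in> B" "v \<in> b"
    using equal_blocks_block[OF assms(1,3)] .
  have bV: "b \<subseteq> {1..N}"
    using assms(1) b(1) by (rule equal_blocks_subset)
  have "(\<Sum>u\<in>{1..N}. edge_prob B p q {v, u}) = (\<Sum>u\<in>{1..N}. if u \<in> b then p else q)"
    using edge_prob_in_block[OF assms(1) b] by simp
  also have "\<dots> = real (card b) * p + real (card ({1..N} - b)) * q"
    using bV by (simp add: sum.If_cases Int_absorb1 Diff_eq Compl_eq)
  also have "real (card ({1..N} - b)) = real N - real (card b)"
    using real_card_Diff[OF finite_atLeastAtMost bV] by simp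
  also have "real (card b) * p + (real N - real (card b)) * q
      = real N / real M * (p + (real M - 1) * q)"
    using assms(2) unfolding equal_blocks_card[OF assms(1) b(1) assms(2)] by (simp add: field_simps)
  finally show ?thesis .
qed

text \<open>Count inter-block slots only. With \<open>n\<close> the block size, \<open>s\<close> the
  size of \<open>S\<close> and \<open>sb b\<close> that of its part in \<open>b\<close>, a vertex of
  \<open>S\<close> in \<open>b\<close> has \<open>N - s - n + sb b\<close> such slots leading out of
  \<open>S\<close>. By Cauchy-Schwarz the squares of \<open>sb b\<close> sum to at least s^2 / M,
  which leaves q (M - 1) s (n - s / M), and s <= N / 2 makes the last factor at least n / 2.\<close>

lemma sum_edge_prob_cut_inter:
  assumes B: "equal_blocks M N B" and M: "0 < M" and p: "0 \<le> p" and q: "0 \<le> q"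
    and S: "S \<subseteq> {1..N}" "2 * card S \<le> N"
  shows "real N / real M * ((real M - 1) * q) * real (card S) / 2
    \<le> (\<Sum>u\<in>S. \<Sum>v\<in>{1..N} - S. edge_prob B p q {u, v})"
proof -
  define n where "n = real N / real M"
  define s where "s = real (card S)"
  define sb where "sb b = real (card (S \<inter> b))" for b
  have fS: "finite S"
    using S(1) finite_subset by blast
  have fB: "finite B" and cB: "card B = M"
    using B M by (auto simp: equal_blocks_def intro: card_ge_0_finite)
  have N: "real N = real M * n"
    using M by (simp add: n_def)
  have S_eq: "S = (\<Union>b\<in>B. S \<inter> b)"
    using S(1) B unfolding equal_blocks_def partition_on_def by blast
  have split: "(\<Sum>u\<in>S. f u) = (\<Sum>b\<in>B. \<Sum>u\<in>S \<inter> b. f u)" for f :: "nat \<Rightarrow> real"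
  proof -
    have "(\<Sum>u\<in>(\<Union>b\<in>B. S \<inter> b). f u) = (\<Sum>b\<in>B. \<Sum>u\<in>S \<inter> b. f u)"
      using fB fS by (intro sum.UNION_disjoint ballI impI) (auto dest: equal_blocks_eq[OF B])
    then show ?thesis
      using S_eq by simp
  qed
  have sum_sb: "(\<Sum>b\<in>B. sb b) = s"
    using split[of "\<lambda>_. 1"] by (simp add: s_def sb_def)
  have row: "q * (real N - s - n + sb b) \<le> (\<Sum>v\<in>{1..N} - S. edge_prob B p q {u, v})"
    if b: "b \<in> B" and u: "u \<in> b" for u b
  proof -
    have bV: "b \<subseteq> {1..N}"
      using B b by (rule equal_blocks_subset)
    then have fb: "finite b"
      using finite_subset by blast
    have "card (S \<union> b) + card (S \<inter> b) = card S + card b"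
      using fS fb by (rule card_Un_Int[symmetric])
    then have "real (card (S \<union> b)) = s + n - sb b"
      using equal_blocks_card[OF B b M] unfolding s_def n_def sb_def by linarith
    moreover have "real (card ({1..N} - (S \<union> b))) = real N - real (card (S \<union> b))"
      using real_card_Diff[OF finite_atLeastAtMost, of "S \<union> b" 1 N] S(1) bV by simp
    ultimately have "q * (real N - s - n + sb b) = (\<Sum>v\<in>{1..N} - (S \<union> b). q)"
      by simp
    also have "\<dots> = (\<Sum>v\<in>{1..N} - (S \<union> b). edge_prob B p q {u, v})"
      using edge_prob_in_block[OF B b u] by (intro sum.cong) auto
    also have "\<dots> \<le> (\<Sum>v\<in>{1..N} - S. edge_prob B p q {u, v})"
      using p q by (intro sum_mono2) (auto simp: edge_prob_def)
    finally show ?thesis .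
  qed
  have "s * s \<le> real M * (\<Sum>b\<in>B. (sb b)\<^sup>2)"
    using sum_squared_le_sum_of_squares[of sb B] by (simp add: sum_sb cB power2_eq_square mult.commute)
  then have sq: "s * s / real M \<le> (\<Sum>b\<in>B. (sb b)\<^sup>2)"
    using M by (simp add: field_simps)
  have "real N / real M * ((real M - 1) * q) * real (card S) / 2 = q * ((real M - 1) * s * (n / 2))"
    by (simp add: n_def s_def)
  also have "\<dots> \<le> q * ((real M - 1) * s * (n - s / real M))"
  proof -
    have "s / real M \<le> n / 2"
      using S(2) M unfolding s_def n_def by (simp add: field_simps)
    then show ?thesis
      using q M by (intro mult_left_mono) (auto simp: s_def)
  qed
  also have "(real M - 1) * s * (n - s / real M) = (real N - s - n) * s + s * s / real M"
    using M by (simp add: N field_simps)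
  also have "q * \<dots> \<le> q * ((real N - s - n) * s + (\<Sum>b\<in>B. (sb b)\<^sup>2))"
    using sq q by (intro mult_left_mono) auto
  also have "\<dots> = (\<Sum>b\<in>B. sb b * (q * (real N - s - n + sb b)))"
    by (simp add: sum_sb[symmetric] sum_distrib_left sum.distrib[symmetric] power2_eq_square algebra_simps)
  also have "\<dots> = (\<Sum>b\<in>B. \<Sum>u\<in>S \<inter> b. q * (real N - s - n + sb b))"
    by (simp add: sb_def)
  also have "\<dots> \<le> (\<Sum>b\<in>B. \<Sum>u\<in>S \<inter> b. \<Sum>v\<in>{1..N} - S. edge_prob B p q {u, v})"
    by (intro sum_mono row) auto
  also have "\<dots> = (\<Sum>u\<in>S. \<Sum>v\<in>{1..N} - S. edge_prob B p q {u, v})"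
    by (rule split[symmetric])
  finally show ?thesis .
qed

lemma sum_edge_prob_cut_single:
  assumes B: "equal_blocks 1 N B" and p: "0 \<le> p" and S: "S \<subseteq> {1..N}" "2 * card S \<le> N"
  shows "real N * p * real (card S) / 2 \<le> (\<Sum>u\<in>S. \<Sum>v\<in>{1..N} - S. edge_prob B p q {u, v})"
proof -
  have "B = {{1..N}}"
    using B unfolding equal_blocks_def partition_on_def by (auto simp: card_1_singleton_iff)
  then have "(\<Sum>u\<in>S. \<Sum>v\<in>{1..N} - S. edge_prob B p q {u, v}) = (\<Sum>u\<in>S. \<Sum>v\<in>{1..N} - S. p)"
    using S(1) by (intro sum.cong refl) (auto simp: edge_prob_def)
  also have "\<dots> = real (card S) * (real (card ({1..N} - S)) * p)"
    by simp
  also have "real (card ({1..N} - S)) = real N - real (card S)"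
    using real_card_Diff[OF finite_atLeastAtMost S(1)] by simp
  finally have "(\<Sum>u\<in>S. \<Sum>v\<in>{1..N} - S. edge_prob B p q {u, v})
      = real (card S) * p * (real N - real (card S))"
    by simp
  moreover have "real (card S) * p * (real N / 2) \<le> real (card S) * p * (real N - real (card S))"
    using S(2) p by (intro mult_left_mono) auto
  ultimately show ?thesis
    by (simp add: mult_ac)
qed

definition sbm_degree :: "nat \<Rightarrow> nat \<Rightarrow> real \<Rightarrow> real \<Rightarrow> real" where
  "sbm_degree M N p q = real N / real M * (p + (real M - 1) * q)"

text \<open>For \<open>M \<ge> 2\<close> a union of blocks is left through inter-block edges only, so intra-block edges
  contribute to the edge boundary in the worst case only if \<open>M = 1\<close>.\<close>

definition sbm_expansion :: "nat \<Rightarrow> nat \<Rightarrow> real \<Rightarrow> real \<Rightarrow> real" where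
  "sbm_expansion M N p q = real N / real M * (if M = 1 then p else (real M - 1) * q)"

lemma sum_edge_prob_cut:
  assumes "equal_blocks M N B" "0 < M" "0 \<le> p" "0 \<le> q" "S \<subseteq> {1..N}" "2 * card S \<le> N"
  shows "sbm_expansion M N p q * real (card S) / 2
    \<le> (\<Sum>u\<in>S. \<Sum>v\<in>{1..N} - S. edge_prob B p q {u, v})"
proof (cases "M = 1")
  case True
  then show ?thesis
    using sum_edge_prob_cut_single[of N B p S q] assms by (simp add: sbm_expansion_def)
next
  case False
  then show ?thesis
    using sum_edge_prob_cut_inter[OF assms] by (simp add: sbm_expansion_def)
qed

section \<open>Union bound over vertices and vertex sets\<close>

text \<open>By the binomial theorem the sum is \<open>(1 + x) ^ card V - 1\<close>. It is the cost
  of a union bound in which a set fails with probability at most \<open>x ^ card S\<close>.\<close>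

lemma sum_nonempty_subsets_le:
  fixes x :: real
  assumes "finite V" "0 \<le> x" "real (card V) * x \<le> 1"
  shows "(\<Sum>S\<in>Pow V - {{}}. x ^ card S) \<le> 2 * (real (card V) * x)"
proof -
  have "(\<Sum>S\<in>Pow V. x ^ card S) = (\<Prod>v\<in>V. x + 1)"
    unfolding prod_add[OF assms(1)] by simp
  then have "(\<Sum>S\<in>Pow V - {{}}. x ^ card S) = (1 + x) ^ card V - 1"
    using assms(1) by (simp add: sum_diff1 add.commute)
  also have "\<dots> \<le> exp x ^ card V - 1"
    using assms(2) exp_ge_add_one_self[of x] by (intro diff_right_mono power_mono) auto
  also have "\<dots> = exp (real (card V) * x) - 1"
    by (simp add: exp_of_nat_mult)
  also have "\<dots> \<le> real (card V) * x + (real (card V) * x)\<^sup>2"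
    using exp_le_quadratic[of "real (card V) * x"] assms(2,3) by simp
  also have "(real (card V) * x)\<^sup>2 \<le> real (card V) * x"
    using assms(2,3) by (simp add: power2_eq_square mult_left_le)
  finally show ?thesis
    by (simp add: mult.commute)
qed

text \<open>The good event. Degrees have to be sharp up to relative error \<open>2 * t\<close>,
  whereas a constant factor lost in the expansion only affects a term that tends to zero.\<close>

definition sbm_regular :: "nat \<Rightarrow> nat \<Rightarrow> real \<Rightarrow> real \<Rightarrow> real \<Rightarrow> nat set set \<Rightarrow> bool" where
  "sbm_regular M N p q t E \<longleftrightarrow> E \<subseteq> edge_slots N
    \<and> (\<forall>v\<in>{1..N}. (1 - 2 * t) * sbm_degree M N p q \<le> real (deg {1..N} E v)
        \<and> real (deg {1..N} E v) \<le> (1 + 2 * t) * sbm_degree M N p q)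
    \<and> weighted_graph.expansion {1..N} (adjacency E) (sbm_expansion M N p q / 4)"

lemma sbm_deg_tail:
  assumes "equal_blocks M N B" "0 < M" "p \<in> {0..1}" "q \<in> {0..1}" "0 < t" "t \<le> 1" "v \<in> {1..N}"
  shows "measure_pmf.prob (sbm N B p q) {E. real (deg {1..N} E v) \<le> (1 - 2 * t) * sbm_degree M N p q}
      \<le> exp (- (t\<^sup>2 * sbm_degree M N p q))" (is ?lower)
    and "measure_pmf.prob (sbm N B p q) {E. (1 + 2 * t) * sbm_degree M N p q \<le> real (deg {1..N} E v)}
      \<le> exp (- (t\<^sup>2 * sbm_degree M N p q))" (is ?upper)
proof -
  let ?J = "(\<lambda>u. {v, u}) ` {1..N}"
  have J: "?J \<subseteq> edge_slots N"
    using assms(7) edge_slotsI by blast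
  have pr: "edge_prob B p q e \<in> {0..1}" for e
    using assms(3,4) by (rule edge_prob_in)
  have "inj_on (\<lambda>u. {v, u}) {1..N}"
    by (auto simp: inj_on_def doubleton_eq_iff)
  then have mean: "(\<Sum>e\<in>?J. edge_prob B p q e) = sbm_degree M N p q"
    using sum_edge_prob_star[OF assms(1,2,7)] by (simp add: sum.reindex sbm_degree_def)
  show ?lower
    using random_subset_lower_tail[where pr = "edge_prob B p q", OF finite_edge_slots J pr assms(5,6)]
    unfolding mean deg_eq_card_Int sbm_eq_random_subset .
  show ?upper
    using random_subset_upper_tail[where pr = "edge_prob B p q", OF finite_edge_slots J pr assms(5,6)]
    unfolding mean deg_eq_card_Int sbm_eq_random_subset .
qed

text \<open>The expected cut is at least half of \<open>sbm_expansion M N p q * card S\<close>. The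
  lower tail with parameter 1/4 gives up another half, hence the 4, and its exponent is 1/16 of the
  mean, hence the 32. The decay is geometric in \<open>card S\<close>, which pays for the number of
  sets.\<close>

lemma sbm_cut_tail:
  assumes "equal_blocks M N B" "0 < M" "p \<in> {0..1}" "q \<in> {0..1}" "S \<subseteq> {1..N}" "2 * card S \<le> N"
  shows "measure_pmf.prob (sbm N B p q)
      {E. weighted_graph.cut {1..N} (adjacency E) S \<le> sbm_expansion M N p q / 4 * real (card S)}
    \<le> exp (- (sbm_expansion M N p q / 32)) ^ card S"
proof -
  let ?J = "(\<lambda>(u, v). {u, v}) ` (S \<times> ({1..N} - S))"
  define \<psi> where "\<psi> = sbm_expansion M N p q"
  define m where "m = (\<Sum>e\<in>?J. edge_prob B p q e)"
  have J: "?J \<subseteq> edge_slots N"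
    using assms(5) by (auto intro!: edge_slotsI)
  have "m = (\<Sum>u\<in>S. \<Sum>v\<in>{1..N} - S. edge_prob B p q {u, v})"
    unfolding m_def by (subst sum.reindex[OF inj_on_doubleton])
      (auto simp: sum.cartesian_product split_def)
  then have m: "\<psi> * real (card S) / 2 \<le> m"
    using sum_edge_prob_cut[OF assms(1,2) _ _ assms(5,6)] assms(3,4) by (simp add: \<psi>_def)
  have "measure_pmf.prob (sbm N B p q) {E. weighted_graph.cut {1..N} (adjacency E) S \<le> \<psi> / 4 * real (card S)}
      \<le> measure_pmf.prob (sbm N B p q) {E. real (card (E \<inter> ?J)) \<le> (1 - 2 * (1 / 4)) * m}"
    unfolding cut_eq_card_Int[OF finite_atLeastAtMost assms(5)]
    using m by (intro measure_pmf.finite_measure_mono) auto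
  also have "\<dots> \<le> exp (- ((1 / 4)\<^sup>2 * m))"
    unfolding m_def sbm_eq_random_subset
    by (rule random_subset_lower_tail[OF finite_edge_slots J edge_prob_in[OF assms(3,4)]]) auto
  also have "\<dots> \<le> exp (real (card S) * - (\<psi> / 32))"
    using m by (simp add: power2_eq_square)
  also have "\<dots> = exp (- (\<psi> / 32)) ^ card S"
    by (rule exp_of_nat_mult)
  finally show ?thesis
    unfolding \<psi>_def .
qed

lemma prob_sbm_regular:
  assumes "equal_blocks M N B" "0 < M" "p \<in> {0..1}" "q \<in> {0..1}" "0 < t" "t \<le> 1"
    and small: "real N * exp (- (sbm_expansion M N p q / 32)) \<le> 1"
  shows "1 - 2 * real N * exp (- (t\<^sup>2 * sbm_degree M N p q))
      - 2 * real N * exp (- (sbm_expansion M N p q / 32))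
    \<le> measure_pmf.prob (sbm N B p q) {E. sbm_regular M N p q t E}"
proof -
  let ?V = "{1..N}" and ?P = "measure_pmf.prob (sbm N B p q)"
  define d where "d = sbm_degree M N p q"
  define \<psi> where "\<psi> = sbm_expansion M N p q"
  define D1 where "D1 v = {E. real (deg ?V E v) \<le> (1 - 2 * t) * d}" for v
  define D2 where "D2 v = {E. (1 + 2 * t) * d \<le> real (deg ?V E v)}" for v
  define T where "T = {S\<in>Pow ?V - {{}}. 2 * card S \<le> N}"
  define C where "C S = {E. weighted_graph.cut ?V (adjacency E) S \<le> \<psi> / 4 * real (card S)}" for S
  have fT: "finite T"
    by (simp add: T_def)
  have supp: "E \<subseteq> edge_slots N" if "E \<in> set_pmf (sbm N B p q)" for E
    using set_random_subset[OF finite_edge_slots] that unfolding sbm_eq_random_subset by blast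
  \<comment> \<open>The inclusion is only claimed almost surely:
    \<open>E \<subseteq> edge_slots N\<close> comes from the support of the model.\<close>
  have "?P {E. \<not> sbm_regular M N p q t E} \<le> ?P ((\<Union>v\<in>?V. D1 v) \<union> (\<Union>v\<in>?V. D2 v) \<union> (\<Union>S\<in>T. C S))"
  proof (rule measure_pmf.finite_measure_mono_AE)
    show "AE E in sbm N B p q. E \<in> {E. \<not> sbm_regular M N p q t E}
        \<longrightarrow> E \<in> (\<Union>v\<in>?V. D1 v) \<union> (\<Union>v\<in>?V. D2 v) \<union> (\<Union>S\<in>T. C S)"
    proof (intro AE_pmfI impI, rule ccontr)
      fix E
      assume E: "E \<in> set_pmf (sbm N B p q)" "E \<in> {E. \<not> sbm_regular M N p q t E}"
        "E \<notin> (\<Union>v\<in>?V. D1 v) \<union> (\<Union>v\<in>?V. D2 v) \<union> (\<Union>S\<in>T. C S)"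
      interpret G: weighted_graph ?V "adjacency E"
        by (rule weighted_graph_adjacency) simp
      have "G.expansion (\<psi> / 4)"
        unfolding G.expansion_def
      proof (intro allI impI)
        fix S assume S: "S \<subseteq> ?V" "S \<noteq> {}" "2 * card S \<le> card ?V"
        then have "S \<in> T"
          by (simp add: T_def)
        then have "E \<notin> C S"
          using E(3) by blast
        then show "\<psi> / 4 * real (card S) \<le> G.cut S"
          by (simp add: C_def)
      qed
      moreover have "(1 - 2 * t) * d \<le> real (deg ?V E v) \<and> real (deg ?V E v) \<le> (1 + 2 * t) * d"
        if "v \<in> ?V" for v
      proof -
        have "E \<notin> D1 v" "E \<notin> D2 v"
          using E(3) that by blast+
        then show ?thesis
          by (simp add: D1_def D2_def)
      qed
      ultimately show False
        using E(2) supp[OF E(1)] by (simp add: sbm_regular_def d_def \<psi>_def)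
    qed
  qed simp
  also have "\<dots> \<le> (?P (\<Union>v\<in>?V. D1 v) + ?P (\<Union>v\<in>?V. D2 v)) + ?P (\<Union>S\<in>T. C S)"
    by (intro order_trans[OF measure_Un_le] add_right_mono measure_Un_le) auto
  also have "?P (\<Union>v\<in>?V. D1 v) \<le> (\<Sum>v\<in>?V. ?P (D1 v))"
    by (rule measure_pmf.finite_measure_subadditive_finite) auto
  also have "\<dots> \<le> (\<Sum>v\<in>?V. exp (- (t\<^sup>2 * d)))"
    unfolding D1_def d_def by (intro sum_mono sbm_deg_tail(1)[OF assms(1-6)])
  also have "?P (\<Union>v\<in>?V. D2 v) \<le> (\<Sum>v\<in>?V. ?P (D2 v))"
    by (rule measure_pmf.finite_measure_subadditive_finite) auto
  also have "\<dots> \<le> (\<Sum>v\<in>?V. exp (- (t\<^sup>2 * d)))"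
    unfolding D2_def d_def by (intro sum_mono sbm_deg_tail(2)[OF assms(1-6)])
  also have "?P (\<Union>S\<in>T. C S) \<le> (\<Sum>S\<in>T. ?P (C S))"
    using fT by (intro measure_pmf.finite_measure_subadditive_finite) auto
  also have "\<dots> \<le> (\<Sum>S\<in>T. exp (- (\<psi> / 32)) ^ card S)"
    unfolding C_def \<psi>_def by (intro sum_mono sbm_cut_tail[OF assms(1-4)]) (auto simp: T_def)
  also have "\<dots> \<le> (\<Sum>S\<in>Pow ?V - {{}}. exp (- (\<psi> / 32)) ^ card S)"
    by (intro sum_mono2) (auto simp: T_def)
  also have "\<dots> \<le> 2 * (real (card ?V) * exp (- (\<psi> / 32)))"
    using small by (intro sum_nonempty_subsets_le) (auto simp: \<psi>_def)
  finally have bad: "?P {E. \<not> sbm_regular M N p q t E}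
      \<le> 2 * real N * exp (- (t\<^sup>2 * d)) + 2 * real N * exp (- (\<psi> / 32))"
    by simp
  have "?P {E. sbm_regular M N p q t E} = 1 - ?P {E. \<not> sbm_regular M N p q t E}"
    using measure_pmf.prob_neg[of "sbm N B p q" "\<lambda>E. sbm_regular M N p q t E"] by simp
  with bad show ?thesis
    by (simp add: d_def \<psi>_def)
qed

subsection \<open>The averaged hitting time\<close>

text \<open>The ratio of the two degree bounds at \<open>t = 1 / ln N\<close>, times the squared
  correction coming from the spectral gap.\<close>

definition upper_factor :: "nat \<Rightarrow> real" where
  "upper_factor N = (1 + 2 / ln N) / (1 - 2 / ln N) * (1 + 2 / sqrt (ln N))\<^sup>2"

text \<open>The inverse ratio of the degree bounds; \<open>3 / N\<close> bounds the stationary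
  weight of \<open>w\<close>.\<close>

definition lower_factor :: "nat \<Rightarrow> real" where
  "lower_factor N = (1 - 2 / ln N) / (1 + 2 / ln N) * (1 - 3 / N)\<^sup>2"

text \<open>On the good event the volume divided by the degree of \<open>w\<close> agrees with
  \<open>N\<close> up to the ratio of the degree bounds, and \<open>gap\<close> makes the remaining
  correction of order \<open>1 / sqrt (ln N)\<close>.\<close>

lemma stat_hit_sbm_regular:
  assumes E: "sbm_regular M N p q (1 / ln N) E" and w: "w \<in> {1..N}" and N: "3 \<le> N" "4 \<le> ln N"
    and d_pos: "0 < sbm_degree M N p q" and \<psi>_pos: "0 < sbm_expansion M N p q"
    and gap: "64 * ln N * sbm_degree M N p q \<le> (sbm_expansion M N p q)\<^sup>2"
  shows "stat_hit {1..N} E w \<le> ennreal (real N * upper_factor N)"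
    and "ennreal (real N * lower_factor N) \<le> stat_hit {1..N} E w"
proof -
  define t where "t = 1 / ln N"
  define d where "d = sbm_degree M N p q"
  define \<psi> where "\<psi> = sbm_expansion M N p q"
  define x where "x = real (deg {1..N} E w)"
  define vol where "vol = (\<Sum>v\<in>{1..N}. real (deg {1..N} E v))"
  define \<Delta> where "\<Delta> = (1 + 2 * t) * d"
  define \<delta> where "\<delta> = (1 - 2 * t) * d"
  have t: "0 < t" "t \<le> 1 / 4"
    using N by (auto simp: t_def field_simps)
  have d: "0 < d" and \<psi>: "0 < \<psi>"
    using d_pos \<psi>_pos by (simp_all add: d_def \<psi>_def)
  have td: "t * d \<le> 1 / 4 * d"
    using t d by (intro mult_right_mono) auto
  have \<delta>: "0 < \<delta>"
    unfolding \<delta>_def using t d by simp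
  have \<Delta>: "0 < \<Delta>" "\<Delta> \<le> 2 * d"
    unfolding \<Delta>_def using t d by simp_all
  \<comment> \<open>For \<open>t\<close> at most 1/4 the ratio of the degree bounds is at most 3/2
    divided by 1/2.\<close>
  have \<Delta>\<delta>: "\<Delta> \<le> 3 * \<delta>"
    using td by (simp add: \<delta>_def \<Delta>_def algebra_simps)
  have bounds: "\<delta> \<le> real (deg {1..N} E v)" "real (deg {1..N} E v) \<le> \<Delta>" if "v \<in> {1..N}" for v
    using E that by (auto simp: sbm_regular_def \<delta>_def \<Delta>_def d_def t_def)
  have x: "\<delta> \<le> x" "x \<le> \<Delta>"
    using bounds[OF w] by (simp_all add: x_def)
  have vol: "real N * \<delta> \<le> vol" "vol \<le> real N * \<Delta>"
    unfolding vol_def using sum_mono[of "{1..N}" "\<lambda>_. \<delta>"] sum_mono[of "{1..N}" _ "\<lambda>_. \<Delta>"] bounds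
    by fastforce+
  have pos: "0 < x" "0 < vol"
    using x vol \<delta> N mult_pos_pos[of "real N" \<delta>] by linarith+
  have \<Delta>_vol: "\<Delta> / vol \<le> 3 / real N"
  proof -
    have "\<Delta> * real N \<le> 3 * \<delta> * real N"
      using \<Delta>\<delta> by (rule mult_right_mono) simp
    also have "\<dots> \<le> 3 * vol"
      using vol(1) by (simp add: mult_ac)
    finally show ?thesis
      using pos N by (simp add: field_simps)
  qed
  have ratio: "\<Delta> / \<delta> = (1 + 2 * t) / (1 - 2 * t)" "\<delta> / \<Delta> = (1 - 2 * t) / (1 + 2 * t)"
    using d by (simp_all add: \<Delta>_def \<delta>_def)
  have edges: "E \<subseteq> {{v, u} | v u. v \<in> {1..N} \<and> u \<in> {1..N}}"
    using E by (simp add: sbm_regular_def edge_slots_def)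
  have deg_pos: "0 < deg {1..N} E v" if "v \<in> {1..N}" for v
    using bounds(1)[OF that] \<delta> by (simp only: of_nat_0_less_iff[where 'a = real, symmetric])
  have expn: "weighted_graph.expansion {1..N} (adjacency E) (\<psi> / 4)"
    using E by (simp add: sbm_regular_def \<psi>_def)
  note main = stat_hit_bounds[OF finite_atLeastAtMost edges w deg_pos bounds(2) _ expn vol_def]
  have "deg {1..N} E w \<le> card {1..N}"
    by (rule card_mono) (auto simp: nbrs_def)
  then have "x \<le> real N"
    by (simp add: x_def)
  then have "x * (\<Delta> / vol) \<le> real N * (3 / real N)"
    using \<Delta>_vol \<Delta> pos N by (intro mult_mono) auto
  \<comment> \<open>A degree is at most \<open>N\<close>, which cancels the \<open>N\<close> in the
    bound \<open>3 / N\<close> for \<open>\<Delta> / vol\<close>.\<close>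
  then have "1 + x * \<Delta> / vol \<le> 4"
    using N by simp
  then have "(1 + x * \<Delta> / vol) * (2 * \<Delta>) \<le> 4 * (2 * (2 * d))"
    using \<Delta> pos d by (intro mult_mono) auto
  then have "sqrt ((1 + x * \<Delta> / vol) * (2 * \<Delta>)) \<le> sqrt (16 * d)"
    by simp
  \<comment> \<open>The 64 in \<open>gap\<close> is 16 times 4: the 16 is used up under the root,
    the 4 gives the 1/2, which division by \<open>\<psi> / 4\<close> turns into 2.\<close>
  also have "\<dots> \<le> 1 / 2 / sqrt (ln N) * \<psi>"
  proof (rule real_le_lsqrt)
    have "16 * d * (4 * ln N) \<le> \<psi>\<^sup>2"
      using gap by (simp add: d_def \<psi>_def mult_ac)
    then show "16 * d \<le> (1 / 2 / sqrt (ln N) * \<psi>)\<^sup>2"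
      using N by (simp add: power_mult_distrib power_divide field_simps)
  qed (use \<psi> N in auto)
  finally have "sqrt ((1 + x * \<Delta> / vol) * (2 * \<Delta>)) / (\<psi> / 4)
      \<le> 1 / 2 / sqrt (ln N) * \<psi> / (\<psi> / 4)"
    using \<psi> by (intro divide_right_mono) auto
  also have "\<dots> = 2 / sqrt (ln N)"
    using \<psi> by simp
  finally have root: "sqrt ((1 + x * \<Delta> / vol) * (2 * \<Delta>)) / (\<psi> / 4) \<le> 2 / sqrt (ln N)" .
  have "stat_hit {1..N} E w
      \<le> ennreal (vol / x * (1 + sqrt ((1 + x * \<Delta> / vol) * (2 * \<Delta>)) / (\<psi> / 4))\<^sup>2)"
    unfolding x_def by (rule main(1)) (use \<psi> in auto)
  also have "\<dots> \<le> ennreal (real N * (\<Delta> / \<delta>) * (1 + 2 / sqrt (ln N))\<^sup>2)"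
  proof (intro ennreal_leI mult_mono power_mono add_left_mono root)
    have "vol / x \<le> real N * \<Delta> / \<delta>"
      using vol(2) x(1) \<delta> \<Delta> by (intro frac_le) auto
    then show "vol / x \<le> real N * (\<Delta> / \<delta>)"
      by simp
    show "0 \<le> 1 + sqrt ((1 + x * \<Delta> / vol) * (2 * \<Delta>)) / (\<psi> / 4)"
      using \<psi> pos \<Delta> by (intro add_nonneg_nonneg divide_nonneg_nonneg) auto
  qed (use \<Delta> \<delta> in auto)
  also have "real N * (\<Delta> / \<delta>) * (1 + 2 / sqrt (ln N))\<^sup>2 = real N * upper_factor N"
    unfolding ratio by (simp add: upper_factor_def t_def)
  finally show "stat_hit {1..N} E w \<le> ennreal (real N * upper_factor N)" .
  have "x / vol \<le> \<Delta> / vol"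
    using x pos by (intro divide_right_mono) auto
  then have "1 - 3 / real N \<le> 1 - x / vol"
    using \<Delta>_vol by linarith
  then have "(1 - 3 / real N)\<^sup>2 \<le> (1 - x / vol)\<^sup>2"
    using N by (intro power_mono) auto
  moreover have "real N * (\<delta> / \<Delta>) \<le> vol / x"
  proof -
    have "real N * \<delta> / \<Delta> \<le> vol / x"
      using vol(1) x(2) pos by (intro frac_le) auto
    then show ?thesis
      by simp
  qed
  ultimately have "real N * (\<delta> / \<Delta>) * (1 - 3 / real N)\<^sup>2 \<le> vol / x * (1 - x / vol)\<^sup>2"
    using pos by (intro mult_mono) auto
  moreover have "vol / x * (1 - x / vol)\<^sup>2 = (vol - x)\<^sup>2 / (vol * x)"
    using pos by (simp add: power2_eq_square field_simps)
  moreover have "real N * (\<delta> / \<Delta>) * (1 - 3 / real N)\<^sup>2 = real N * lower_factor N"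
    unfolding ratio by (simp add: lower_factor_def t_def)
  ultimately have "ennreal (real N * lower_factor N) \<le> ennreal ((vol - x)\<^sup>2 / (vol * x))"
    by (intro ennreal_leI) simp
  also have "\<dots> \<le> stat_hit {1..N} E w"
    unfolding x_def by (rule main(2)) (use \<psi> in auto)
  finally show "ennreal (real N * lower_factor N) \<le> stat_hit {1..N} E w" .
qed

section \<open>Asymptotics along multiples of the number of blocks\<close>

lemma factor_gap_tendsto_0: "(\<lambda>N. upper_factor N - lower_factor N) \<longlonglongrightarrow> 0"
  unfolding upper_factor_def lower_factor_def by real_asymp

text \<open>Both the ratio and 1 lie between \<open>l\<close> and \<open>u\<close>, so the width of
  that interval serves as a two-sided error.\<close>

lemma abs_ratio_minus_1_le:
  assumes "ennreal (n * l) \<le> X" "X \<le> ennreal (n * u)" "0 < n" "0 \<le> l" "l \<le> 1" "1 \<le> u"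
  shows "\<bar>enn2ereal X / ereal n - 1\<bar> \<le> ereal (u - l)"
proof -
  obtain r where r: "X = ennreal r" "0 \<le> r"
    using assms(2) by (cases X) (auto simp: top_unique)
  have "n * l \<le> r" "r \<le> n * u"
    using assms r by (auto simp: ennreal_le_iff ennreal_le_iff2)
  then have "l \<le> r / n" "r / n \<le> u"
    using assms(3) by (simp_all add: field_simps)
  then have "\<bar>r / n - 1\<bar> \<le> u - l"
    using assms(5,6) by (simp add: abs_le_iff)
  moreover have "enn2ereal X / ereal n - 1 = ereal (r / n - 1)"
    using assms(3) r by (simp add: one_ereal_def)
  ultimately show ?thesis
    by simp
qed

lemma eventually_multiples_at_top:
  "eventually P at_top \<Longrightarrow> eventually P (multiples_at_top M)"
  "eventually (\<lambda>N. M dvd N \<and> M < N) (multiples_at_top M)"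
proof -
  show "eventually P at_top \<Longrightarrow> eventually P (multiples_at_top M)"
    unfolding multiples_at_top_def by (rule filter_leD[OF inf_le1])
  have "eventually (\<lambda>N. M dvd N) (multiples_at_top M)"
    unfolding multiples_at_top_def by (rule filter_leD[OF inf_le2]) (simp add: eventually_principal)
  moreover have "eventually (\<lambda>N. M < N) (multiples_at_top M)"
    unfolding multiples_at_top_def by (rule filter_leD[OF inf_le1 eventually_gt_at_top])
  ultimately show "eventually (\<lambda>N. M dvd N \<and> M < N) (multiples_at_top M)"
    by (rule eventually_conj)
qed

lemma tendsto_multiples_at_top:
  "(f \<longlongrightarrow> l) at_top \<Longrightarrow> (f \<longlongrightarrow> l) (multiples_at_top M)"
  unfolding multiples_at_top_def by (rule tendsto_mono[OF inf_le1])

text \<open>If \<open>M = 1\<close> or inter-block edges make up at least half of the expected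
  degree, the expansion is at least half of the degree and \<open>deg\<close> suffices. Otherwise
  the degree is at most twice its intra-block part, and \<open>inter\<close> gives (n q)^2 >= 128 n
  p ln N for the block size n.\<close>

lemma sbm_gap:
  assumes M: "1 \<le> M" and p: "p \<in> {0..1}" and q: "0 < q" and N: "M < N" "4 \<le> ln N"
    and deg: "256 * ln N ^ 4 \<le> sbm_degree M N p q"
    and inter: "sqrt (p * ln N / (real N * real M)) / q \<le> 1 / (12 * real M)"
  shows "64 * ln N * sbm_degree M N p q \<le> (sbm_expansion M N p q)\<^sup>2"
proof -
  define n where "n = real N / real M"
  define L where "L = ln (real N)"
  define d where "d = sbm_degree M N p q"
  define \<psi> where "\<psi> = sbm_expansion M N p q"
  have n: "0 < n" and L: "4 \<le> L"
    using M N by (auto simp: n_def L_def)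
  have "L ^ 1 \<le> L ^ 4"
    using L by (intro power_increasing) auto
  then have dL: "256 * L \<le> d"
    using deg by (simp add: d_def L_def)
  \<comment> \<open>Since 256 is 4 times 64, \<open>dL\<close> bounds \<open>64 * L * d\<close> by
    the square of \<open>d / 2\<close>.\<close>
  have large: "64 * L * d \<le> \<psi>\<^sup>2" if "d \<le> 2 * \<psi>"
  proof -
    have "64 * L * d \<le> d / 4 * d"
      using dL L by (intro mult_right_mono) auto
    also have "\<dots> = (d / 2)\<^sup>2"
      by (simp add: power2_eq_square)
    also have "\<dots> \<le> \<psi>\<^sup>2"
      using that dL L by (intro power_mono) auto
    finally show ?thesis .
  qed
  consider "M = 1" | "M \<noteq> 1" "p \<le> (real M - 1) * q" | "M \<noteq> 1" "(real M - 1) * q < p"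
    by linarith
  then show ?thesis
  proof cases
    case 1
    then have "d \<le> 2 * \<psi>"
      using p by (simp add: d_def \<psi>_def sbm_degree_def sbm_expansion_def)
    then show ?thesis
      using large by (simp add: d_def \<psi>_def L_def)
  next
    case 2
    have "n * p \<le> n * ((real M - 1) * q)"
      using n 2(2) by (intro mult_left_mono) auto
    moreover have "\<psi> = n * ((real M - 1) * q)"
      using 2(1) by (simp add: \<psi>_def sbm_expansion_def n_def)
    moreover have "d = n * p + n * ((real M - 1) * q)"
      by (simp add: d_def sbm_degree_def n_def distrib_left)
    ultimately have "d \<le> 2 * \<psi>"
      by linarith
    then show ?thesis
      using large by (simp add: d_def \<psi>_def L_def)
  next
    case 3
    have M2: "2 \<le> real M"
      using M 3(1) by linarith
    have "sqrt (p * L / (real N * real M)) \<le> q / (12 * real M)"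
      using inter q by (simp add: L_def field_simps)
    then have "p * L / (real N * real M) \<le> (q / (12 * real M))\<^sup>2"
      by (rule sqrt_le_D)
    then have "144 * (p * L) \<le> n * q\<^sup>2"
      using M N by (simp add: n_def power2_eq_square field_simps)
    \<comment> \<open>The 128 is 64 times the factor 2 in \<open>d \<le> n * (2 * p)\<close>; the
      144 is the square of 12.\<close>
    then have pL: "128 * (p * L) \<le> n * q\<^sup>2"
      using p L by (smt (verit) atLeastAtMost_iff mult_nonneg_nonneg)
    have "d \<le> n * (2 * p)"
      using 3(2) n by (simp add: d_def sbm_degree_def n_def[symmetric])
    then have "64 * L * d \<le> 64 * L * (n * (2 * p))"
      using L by (intro mult_left_mono) auto
    also have "\<dots> = n * (128 * (p * L))"
      by simp
    also have "\<dots> \<le> n * (n * q\<^sup>2)"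
      using pL n by (intro mult_left_mono) auto
    also have "\<dots> = (n * (1 * q))\<^sup>2"
      by (simp add: power2_eq_square)
    also have "\<dots> \<le> (n * ((real M - 1) * q))\<^sup>2"
      using n q M2 by (intro power_mono mult_left_mono mult_right_mono) auto
    also have "\<dots> = \<psi>\<^sup>2"
      using 3(1) by (simp add: \<psi>_def sbm_expansion_def n_def)
    finally show ?thesis
      by (simp add: d_def \<psi>_def L_def)
  qed
qed

text \<open>Both exponents in \<open>prob_sbm_regular\<close> are at least 2 ln N, so each failure
  term is at most 2 / N. For degrees, accuracy \<open>1 / ln N\<close> costs a factor (ln N)^2 of
  the lower bound \<open>256 * ln N ^ 4\<close>; for cuts, \<open>gap\<close> forces the expansion
  to be at least 64 ln N.\<close>

lemma prob_stat_hit_near: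
  assumes M: "1 \<le> M" and B: "equal_blocks M N B" and p: "p \<in> {0..1}" and q: "q \<in> {0..1}"
    and w: "w \<in> {1..N}" and N: "3 \<le> N" "4 \<le> ln N"
    and deg: "256 * ln N ^ 4 \<le> sbm_degree M N p q"
    and gap: "64 * ln N * sbm_degree M N p q \<le> (sbm_expansion M N p q)\<^sup>2"
  shows "1 - 4 / real N \<le> measure_pmf.prob (sbm N B p q)
    {E. \<bar>enn2ereal (stat_hit {1..N} E w) / ereal (real N) - 1\<bar> \<le> ereal (upper_factor N - lower_factor N)}"
proof -
  define L where "L = ln (real N)"
  define d where "d = sbm_degree M N p q"
  define \<psi> where "\<psi> = sbm_expansion M N p q"
  have L: "4 \<le> L"
    using N by (simp add: L_def)
  have "0 < 256 * L ^ 4"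
    using L by simp
  then have d: "0 < d"
    using deg unfolding d_def L_def by linarith
  have "\<psi> \<le> d" "0 \<le> \<psi>"
    using M p q
    by (auto simp: \<psi>_def d_def sbm_expansion_def sbm_degree_def intro!: divide_right_mono mult_left_mono)
  \<comment> \<open>Replacing one factor \<open>\<psi>\<close> in \<open>gap\<close> by the larger
    \<open>d\<close> allows \<open>d\<close> to be cancelled.\<close>
  have "64 * L * d \<le> \<psi> * d"
  proof -
    have "\<psi> * \<psi> \<le> \<psi> * d"
      using \<open>\<psi> \<le> d\<close> \<open>0 \<le> \<psi>\<close> by (rule mult_left_mono)
    then show ?thesis
      using gap by (simp add: \<psi>_def d_def L_def power2_eq_square)
  qed
  then have \<psi>: "64 * L \<le> \<psi>"
    using d by simp
  have small: "real N * exp (- y) \<le> 1 / real N" if "2 * L \<le> y" for y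
  proof -
    have "real N * exp (- y) \<le> real N * exp (- (L + L))"
      using that by (intro mult_left_mono) auto
    also have "\<dots> = 1 / real N"
      using N exp_ln[of "real N"] unfolding exp_minus exp_add L_def by (simp add: field_simps)
    finally show ?thesis .
  qed
  have cut_small: "real N * exp (- (\<psi> / 32)) \<le> 1 / real N"
    using \<psi> by (intro small) simp
  have "2 * L \<le> (1 / L)\<^sup>2 * d"
  proof -
    have "2 * L ^ 3 \<le> 256 * L ^ 4"
      using L by (intro mult_mono power_increasing) auto
    then have "2 * L * L\<^sup>2 \<le> d"
      using deg by (simp add: d_def L_def power2_eq_square power3_eq_cube)
    then show ?thesis
      using L by (simp add: power_divide field_simps)
  qed
  then have deg_small: "real N * exp (- ((1 / L)\<^sup>2 * d)) \<le> 1 / real N"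
    by (rule small)
  have "1 - 4 / real N \<le> 1 - 2 * real N * exp (- ((1 / L)\<^sup>2 * d)) - 2 * real N * exp (- (\<psi> / 32))"
    using cut_small deg_small by simp
  also have "\<dots> \<le> measure_pmf.prob (sbm N B p q) {E. sbm_regular M N p q (1 / L) E}"
    unfolding d_def \<psi>_def
  proof (rule prob_sbm_regular[OF B _ p q])
    have "1 / real N \<le> 1"
      using N by simp
    then show "real N * exp (- (sbm_expansion M N p q / 32)) \<le> 1"
      using cut_small unfolding \<psi>_def by linarith
  qed (use M L in auto)
  also have "\<dots> \<le> measure_pmf.prob (sbm N B p q)
    {E. \<bar>enn2ereal (stat_hit {1..N} E w) / ereal (real N) - 1\<bar> \<le> ereal (upper_factor N - lower_factor N)}"
  proof (intro measure_pmf.finite_measure_mono subsetI CollectI)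
    fix E assume "E \<in> {E. sbm_regular M N p q (1 / L) E}"
    then have E: "sbm_regular M N p q (1 / ln N) E"
      by (simp add: L_def)
    have "1 \<le> (1 + y) / (1 - y)" "(1 - y) / (1 + y) \<le> 1" "0 \<le> (1 - y) / (1 + y)"
      if "0 < y" "y < 1" for y :: real
      using that by (simp_all add: divide_le_eq_1 le_divide_eq_1)
    from this[of "2 / L"] have "1 \<le> (1 + 2 / L) / (1 - 2 / L)" "(1 - 2 / L) / (1 + 2 / L) \<le> 1"
      "0 \<le> (1 - 2 / L) / (1 + 2 / L)"
      using L by simp_all
    moreover have "1 \<le> (1 + 2 / sqrt L)\<^sup>2"
      using L by (intro one_le_power) simp
    moreover have "(1 - 3 / real N)\<^sup>2 \<le> 1"
      using N by (intro power_le_one) auto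
    ultimately have "1 * 1 \<le> upper_factor N" "lower_factor N \<le> 1" "0 \<le> lower_factor N"
      unfolding upper_factor_def lower_factor_def L_def[symmetric]
      by (intro mult_mono mult_le_one mult_nonneg_nonneg zero_le_power2; simp)+
    then show "\<bar>enn2ereal (stat_hit {1..N} E w) / ereal (real N) - 1\<bar> \<le> ereal (upper_factor N - lower_factor N)"
      using stat_hit_sbm_regular[OF E w N] d \<psi> L gap N
      by (intro abs_ratio_minus_1_le) (auto simp: d_def \<psi>_def)
  qed simp
  finally show ?thesis .
qed

theorem theorem8p2:
  fixes M :: nat and p q :: "nat \<Rightarrow> real" and B :: "nat \<Rightarrow> nat set set"
    and \<kappa> :: ennreal and w :: "nat \<Rightarrow> nat"
  assumes "1 \<le> M"
    and "\<And>N. p N \<in> {0..1}" and "\<And>N. q N \<in> {0..1}"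
    and "\<And>N. M dvd N \<Longrightarrow> M < N \<Longrightarrow> equal_blocks M N (B N)"
    and "quot_tendsto_0 (multiples_at_top M) (\<lambda>N. real M * ln (real N) ^ 4)
           (\<lambda>N. real N * p N + real N * (real M - 1) * q N)"
    and "quot_tendsto_0 (multiples_at_top M) (\<lambda>N. sqrt (p N * ln (real N) / (real N * real M))) q"
    and "((\<lambda>N. ennreal ((real M - 1) * q N) / ennreal (p N)) \<longlongrightarrow> \<kappa>) (multiples_at_top M)"
    and "\<And>N. M dvd N \<Longrightarrow> M < N \<Longrightarrow> w N \<in> {1..N}"
  shows "aas_asymp (multiples_at_top M) (\<lambda>N. sbm N (B N) (p N) (q N))
           (\<lambda>N E. stat_hit {1..N} E (w N)) real"
proof -
  let ?F = "multiples_at_top M"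
  let ?D = "\<lambda>N. real N * p N + real N * (real M - 1) * q N"
  \<comment> \<open>The width of the interval between the two factors is the deterministic error; it
    depends on \<open>N\<close> alone.\<close>
  define near where "near N E \<longleftrightarrow> \<bar>enn2ereal (stat_hit {1..N} E (w N)) / ereal (real N) - 1\<bar>
    \<le> ereal (upper_factor N - lower_factor N)" for N E
  have "((\<lambda>N. real M * ln (real N) ^ 4 / ?D N) \<longlongrightarrow> 0) ?F"
    using assms(5) unfolding quot_tendsto_0_def by simp
  \<comment> \<open>The thresholds \<open>1 / 256\<close> here and \<open>1 / (12 * real M)\<close>
    below are those of \<open>prob_stat_hit_near\<close> and \<open>sbm_gap\<close>.\<close>
  then have "eventually (\<lambda>N. real M * ln (real N) ^ 4 / ?D N < 1 / 256) ?F"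
    by (rule order_tendstoD) simp
  moreover have "eventually (\<lambda>N. ?D N \<noteq> 0) ?F"
    using assms(5) unfolding quot_tendsto_0_def by simp
  moreover have "((\<lambda>N. sqrt (p N * ln (real N) / (real N * real M)) / q N) \<longlongrightarrow> 0) ?F"
    using assms(6) unfolding quot_tendsto_0_def by simp
  then have "eventually (\<lambda>N. sqrt (p N * ln (real N) / (real N * real M)) / q N < 1 / (12 * real M)) ?F"
    by (rule order_tendstoD) (use assms(1) in simp)
  moreover have "eventually (\<lambda>N. q N \<noteq> 0) ?F"
    using assms(6) unfolding quot_tendsto_0_def by simp
  moreover have "eventually (\<lambda>N. 3 \<le> N \<and> 4 \<le> ln (real N)) ?F"
    by (intro eventually_multiples_at_top(1) eventually_conj eventually_ge_at_top) real_asymp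
  ultimately have ev: "eventually (\<lambda>N. 1 - 4 / real N
      \<le> measure_pmf.prob (sbm N (B N) (p N) (q N)) {E. near N E}) ?F"
    using eventually_multiples_at_top(2)[of M]
  proof eventually_elim
    case (elim N)
    \<comment> \<open>At a zero of \<open>?D N\<close> the quotient would be 0 by convention and say
      nothing; nonnegativity and nonvanishing together allow the denominator to be cleared.\<close>
    have "0 \<le> ?D N"
      using assms(1) assms(2,3)[of N] by (intro add_nonneg_nonneg mult_nonneg_nonneg) auto
    then have D: "0 < ?D N"
      using elim by simp
    have "?D N = real M * sbm_degree M N (p N) (q N)"
      using assms(1) by (simp add: sbm_degree_def distrib_left mult.assoc)
    moreover have "256 * (real M * ln (real N) ^ 4) \<le> ?D N"
      using elim(1) D by (simp only: divide_less_eq if_True) simp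
    ultimately have "real M * (256 * ln (real N) ^ 4) \<le> real M * sbm_degree M N (p N) (q N)"
      by (simp only: mult.left_commute)
    then have "256 * ln (real N) ^ 4 \<le> sbm_degree M N (p N) (q N)"
      using assms(1) by simp
    moreover from this have "64 * ln N * sbm_degree M N (p N) (q N) \<le> (sbm_expansion M N (p N) (q N))\<^sup>2"
      using elim assms(1) assms(2,3)[of N] by (intro sbm_gap) auto
    ultimately show ?case
      unfolding near_def using elim assms by (intro prob_stat_hit_near) auto
  qed
  have "((\<lambda>N. measure_pmf.prob (sbm N (B N) (p N) (q N)) {E. near N E}) \<longlongrightarrow> 1) ?F"
  proof (rule tendsto_sandwich[OF ev _ _ tendsto_const])
    have "(\<lambda>N. 1 - 4 / real N) \<longlonglongrightarrow> 1"
      by real_asymp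
    then show "((\<lambda>N. 1 - 4 / real N) \<longlongrightarrow> 1) ?F"
      by (rule tendsto_multiples_at_top)
  qed simp
  then show ?thesis
    unfolding aas_asymp_def aas_def near_def
    by (intro exI[of _ "\<lambda>N. upper_factor N - lower_factor N"] conjI
        tendsto_multiples_at_top[OF factor_gap_tendsto_0])
qed

end
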